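(* Let $\beta\in\mathbb{R}$ and let $p$ be analytic on $\mathbb{D}$ with $p(0)=1$ and $1+\beta zp'(z)\prec\varphi_{Ne}(z)=1+z-z^3/3$. Then the following subordinations hold: (a) $p(z)\prec\sqrt{1+z^2}+z$ whenever $\beta\geq\frac{4}{9}(2+\sqrt{2})\approx1.51743$. (b) $p(z)\prec1+\frac{4}{3}z+\frac{2}{3}z^2$ whenever $\beta\geq\frac{4}{3}$. (c) $p(z)\prec1+\sqrt{2}z+\frac{1}{2}z^2$ whenever $\beta\geq\frac{16}{63}(1+2\sqrt{2})\approx0.972299$. (d) $p(z)\prec e^z$ whenever $\beta\geq\frac{8e}{9(e-1)}\approx1.4062$. (e) $p(z)\prec1+\sin z$ whenever $\beta\geq\frac{8}{9\sin1}\approx1.05635$. (f) $p(z)\prec1+\frac{z}{k}\left(\frac{k+z}{k-z}\right)$, where $k=1+\sqrt{2}$, whenever $\beta\geq\frac{8}{9}(3+2\sqrt{2})\approx5.18082$. (g) $p(z)\prec\varphi_{Ne}(z)$ whenever $\beta\geq\frac{4}{3}$. The bounds on $\beta$ are sharp, i.e. in each part the lower bound on $\beta$ cannot be replaced by a smaller number.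
   Context: $\mathbb{D}$ is the open unit disk. For analytic $f,g$ on $\mathbb{D}$, $f\prec g$ means there is an analytic $w$ on $\mathbb{D}$ with $w(0)=0$, $|w(z)|<1$ and $f(z)=g(w(z))$ on $\mathbb{D}$. The principal branch of the square root is used. *)

theory Defs
  imports "HOL-Complex_Analysis.Complex_Analysis"
begin

(* Subordination on the unit disk ball 0 1; meant for f, g analytic there. *)
definition subordinate :: "(complex \<Rightarrow> complex) \<Rightarrow> (complex \<Rightarrow> complex) \<Rightarrow> bool" where
  "subordinate f g \<longleftrightarrow>
     (\<exists>w. w analytic_on ball 0 1 \<and> w 0 = 0 \<and>
          (\<forall>z\<in>ball 0 1. norm (w z) < 1 \<and> f z = g (w z)))"

definition phi_Ne :: "complex \<Rightarrow> complex" where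
  "phi_Ne z = 1 + z - z ^ 3 / 3"

definition admissible :: "real \<Rightarrow> (complex \<Rightarrow> complex) \<Rightarrow> bool" where
  "admissible \<beta> p \<longleftrightarrow>
     p analytic_on ball 0 1 \<and> p 0 = 1 \<and>
     subordinate (\<lambda>z. 1 + of_real \<beta> * z * deriv p z) phi_Ne"

definition valid_bound :: "real \<Rightarrow> (complex \<Rightarrow> complex) \<Rightarrow> bool" where
  "valid_bound b P \<longleftrightarrow> (\<forall>\<beta>\<ge>b. \<forall>p. admissible \<beta> p \<longrightarrow> subordinate p P)"

definition sharp_bound :: "real \<Rightarrow> (complex \<Rightarrow> complex) \<Rightarrow> bool" where
  "sharp_bound b P \<longleftrightarrow> valid_bound b P \<and> (\<forall>b'<b. \<not> valid_bound b' P)"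

end

theory Submission
  imports Defs
begin

text \<open>Let \<open>P\<close> be one of the seven superordinates. With \<open>U(z) = (9z - z\<^sup>3)/8\<close> and \<open>\<beta> = 8/(9s)\<close> the
  function \<open>Q = 1 + sU\<close> solves \<open>1 + \<beta>zQ'(z) = \<phi>\<^sub>N\<^sub>e(z)\<close>, and it dominates every \<open>p\<close> satisfying the
  hypothesis with a constant at least \<open>\<beta>\<close>: at a first exit of \<open>p\<close> from \<open>Q(\<D>)\<close>, Jack's lemma makes
  \<open>zp'(z)\<close> a multiple, with factor at least 1, of a boundary value of \<open>zQ'(z)\<close>, which is impossible since
  the nephroid domain is starlike. Hence the sharp constant corresponds to the largest \<open>s\<close> with
  \<open>Q(\<D>) \<subseteq> P(\<D>)\<close>. This is always \<open>s = 1 - P(-1)\<close>, where both boundaries meet at \<open>P(-1)\<close>; for \<open>P\<close> univalent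
  the inclusion follows once \<open>P\<close> maps no point of the unit circle into \<open>Q(\<D>)\<close>. For the exponential and
  the sine one needs that the boundary of \<open>U(\<D>)\<close> is flat to third order at \<open>\<plusminus>1\<close>.\<close>

section \<open>Starlikeness of the nephroid domain\<close>

text \<open>The nephroid bounding the image of \<open>3z - z\<^sup>3\<close> has the equation \<open>(|v|\<^sup>2 - 4)\<^sup>3 = 108 (Im v)\<^sup>2\<close>;
  in this implicit form starlikeness is visible from the degrees.\<close>

lemma nephroid_interior:
  assumes "norm z < 1"
  shows "((norm (3 * z - z ^ 3))\<^sup>2 - 4) ^ 3 < 108 * (Im (3 * z - z ^ 3))\<^sup>2"
proof -
  define x y r where "x = Re z" "y = Im z" "r = x\<^sup>2 + y\<^sup>2"
  have z: "z = Complex x y" by (simp add: x_y_r_def)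
  have r: "0 \<le> r" "r < 1"
    using assms by (auto simp: x_y_r_def cmod_def)
  \<comment> \<open>The imaginary part of \<open>3 * z - z ^ 3\<close> factors as
    \<open>y * Y\<close>. For \<open>r = 1\<close> one has \<open>Y = 4 * y\<^sup>2\<close> and the
    base of the cube is \<open>12 * y\<^sup>2\<close>; both estimates below compare with these
    boundary values, for which the curve equation is an identity.\<close>
  define Y where "Y = 3 * (1 - r) + 4 * y\<^sup>2"
  have im: "Im (3 * z - z ^ 3) = y * Y"
    by (simp add: z x_y_r_def(3) Y_def power3_eq_cube power2_eq_square algebra_simps)
  have N: "(norm (3 * z - z ^ 3))\<^sup>2 - 4 = 12 * r * y\<^sup>2 - (1 - r)\<^sup>2 * (4 - r)"
    unfolding cmod_power2 z x_y_r_def(3)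
    by (simp add: power3_eq_cube power2_eq_square algebra_simps)
  have pos: "(1 - r)\<^sup>2 * (4 - r) > 0" using r by simp
  show ?thesis
  proof (cases "y = 0")
    case True
    then show ?thesis unfolding im N using pos
      by (simp add: power3_eq_cube zero_less_mult_iff)
  next
    case False
    have yr: "0 < y\<^sup>2" "y\<^sup>2 \<le> r" using False by (auto simp: x_y_r_def(3))
    have "r * y\<^sup>2 \<le> 1 * y\<^sup>2" using r yr by (intro mult_right_mono) auto
    then have less: "12 * r * y\<^sup>2 - (1 - r)\<^sup>2 * (4 - r) < 12 * y\<^sup>2" (is "?b < _")
      using pos by simp
    have "?b ^ 3 < (12 * y\<^sup>2) ^ 3"
    proof (cases "?b \<ge> 0")
      case False
      then have "?b ^ 3 < 0" by simp
      also have "0 \<le> (12 * y\<^sup>2) ^ 3" by simp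
      finally show ?thesis .
    next
      case True
      then show ?thesis by (rule power_strict_mono[OF less]) simp
    qed
    also have "(12 * y\<^sup>2) ^ 3 = 108 * y\<^sup>2 * (4 * y\<^sup>2)\<^sup>2" by (simp add: power3_eq_cube power2_eq_square)
    also have "\<dots> \<le> 108 * y\<^sup>2 * Y\<^sup>2"
      using r by (intro mult_left_mono power_mono) (auto simp: Y_def)
    finally show ?thesis unfolding im N by (simp add: power_mult_distrib algebra_simps)
  qed
qed

text \<open>In terms of \<open>Im z\<close> both sides of the curve equation become
  \<open>1728 * Im z ^ 6\<close>, so the unit circle parametrises the nephroid.\<close>

lemma nephroid_boundary:
  assumes "norm z = 1"
  shows "(norm (3 * z - z ^ 3))\<^sup>2 - 4 = 12 * (Im z)\<^sup>2" "Im (3 * z - z ^ 3) = 4 * Im z ^ 3"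
proof -
  define x y where "x = Re z" "y = Im z"
  have z: "z = Complex x y" by (simp add: x_y_def)
  have xy: "x\<^sup>2 = 1 - y\<^sup>2" using assms by (simp add: x_y_def cmod_def)
  have "(norm (3 * z - z ^ 3))\<^sup>2 = (x\<^sup>2 + y\<^sup>2) * (9 - 6 * (x\<^sup>2 - y\<^sup>2) + (x\<^sup>2 + y\<^sup>2)\<^sup>2)"
    unfolding cmod_power2 z by (simp add: power3_eq_cube power2_eq_square algebra_simps)
  then show "(norm (3 * z - z ^ 3))\<^sup>2 - 4 = 12 * (Im z)\<^sup>2"
    by (simp add: xy z)
  have "Im (3 * z - z ^ 3) = y * (3 - 3 * x\<^sup>2 + y\<^sup>2)"
    by (simp add: z power3_eq_cube power2_eq_square algebra_simps)
  then show "Im (3 * z - z ^ 3) = 4 * Im z ^ 3"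
    unfolding xy by (simp add: z power3_eq_cube power2_eq_square algebra_simps)
qed

text \<open>Scaling a boundary point by \<open>m\<close> multiplies the right side of the curve
  equation by \<open>m\<^sup>2\<close>, but the left side by at least \<open>m ^ 6\<close>. The
  scaled point thus violates the strict inequality of \<open>nephroid_interior\<close>.\<close>

lemma nephroid_boundary_multiple:
  fixes \<xi> \<zeta> :: complex
  assumes "norm \<xi> < 1" "norm \<zeta> = 1" "m \<ge> 1"
  shows "of_real m * (3 * \<zeta> - \<zeta> ^ 3) \<noteq> 3 * \<xi> - \<xi> ^ 3"
proof
  let ?v = "3 * \<zeta> - \<zeta> ^ 3" and ?y = "(Im \<zeta>)\<^sup>2"
  assume eq: "of_real m * ?v = 3 * \<xi> - \<xi> ^ 3"
  have N: "(norm ?v)\<^sup>2 = 4 + 12 * ?y" using nephroid_boundary(1)[OF assms(2)] by simp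
  have m2: "m\<^sup>2 \<ge> 1" using assms(3) by simp
  have "m\<^sup>2 * 108 * (Im ?v)\<^sup>2 = m\<^sup>2 * (12 * ?y) ^ 3"
    unfolding nephroid_boundary(2)[OF assms(2)]
    by (simp add: power_mult_distrib)
  also have "\<dots> \<le> (m\<^sup>2) ^ 3 * (12 * ?y) ^ 3"
    using m2 power_increasing[of 1 3 "m\<^sup>2"] by (intro mult_right_mono) auto
  also have "\<dots> = (m\<^sup>2 * (12 * ?y)) ^ 3" by (simp add: power_mult_distrib)
  also have "\<dots> \<le> ((norm (of_real m * ?v))\<^sup>2 - 4) ^ 3"
  proof (rule power_mono)
    have "(norm (of_real m * ?v))\<^sup>2 = m\<^sup>2 * (4 + 12 * ?y)"
      by (simp only: norm_mult power_mult_distrib N) simp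
    then show "m\<^sup>2 * (12 * ?y) \<le> (norm (of_real m * ?v))\<^sup>2 - 4"
      using m2 by (simp add: algebra_simps)
  qed simp
  also have "\<dots> < 108 * (Im (of_real m * ?v))\<^sup>2"
    using nephroid_interior[OF assms(1)] unfolding eq .
  finally show False by (simp add: power_mult_distrib)
qed

section \<open>Jack's lemma and the dominant\<close>

text \<open>Rescale so that the contact point and its image are both 1. Schwarz gives
  \<open>norm (\<omega> z) \<le> norm z\<close>, with equality at 1; comparing one-sided derivatives
  at 1 in all directions pointing into the disk forces \<open>c\<close>, the derivative of
  \<open>\<omega>\<close> there, to be real and at least 1.\<close>

lemma Jack:
  fixes w :: "complex \<Rightarrow> complex"
  assumes holw: "w holomorphic_on ball 0 r" and "r > 0" and w0: "w 0 = 0"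
    and less: "\<And>z. norm z < r \<Longrightarrow> norm (w z) < 1"
    and z0: "norm z0 = r" and w1: "norm (w z0) = 1"
    and der: "(w has_field_derivative d) (at z0)"
  shows "\<exists>m\<ge>1. z0 * d = of_real m * w z0"
proof -
  define \<omega> where "\<omega> z = w (z0 * z) / w z0" for z
  define c where "c = z0 * d / w z0"
  have nz: "w z0 \<noteq> 0" using w1 by auto
  have sub: "norm (z0 * z) < r" if "norm z < 1" for z
    using that z0 \<open>r > 0\<close> by (simp add: norm_mult)
  have Schwarz: "norm (\<omega> z) \<le> norm z" if "norm z < 1" for z
  proof (rule Schwarz_Lemma(1)[OF _ _ _ that])
    show "\<omega> holomorphic_on ball 0 1"
      unfolding \<omega>_def using nz sub
      by (intro holomorphic_intros holomorphic_on_compose_gen[OF _ holw, unfolded o_def]) auto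
  qed (use sub less w0 w1 in \<open>auto simp: \<omega>_def norm_divide\<close>)
  have key: "Re (c * v) \<le> Re v" if v: "Re v < 0" for v
  proof (rule ccontr)
    assume "\<not> Re (c * v) \<le> Re v"
    then have pos: "Re (c * v) - Re v > 0" by simp
    have "((\<lambda>t. \<omega> (1 + of_real t * v)) has_vector_derivative c * v) (at 0)"
      unfolding \<omega>_def c_def
      by (rule has_vector_derivative_real_field)
        (auto simp: der nz intro!: derivative_eq_intros DERIV_chain2[of w d "\<lambda>t. z0 * (1 + t * v)"])
    then have "((\<lambda>t. Re (\<omega> (1 + of_real t * v))) has_real_derivative Re (c * v)) (at 0)"
      by (rule has_field_derivative_Re)
    moreover have "((\<lambda>t. norm (1 + of_real t * v)) has_real_derivative Re v) (at 0)"
      unfolding cmod_def by (auto intro!: derivative_eq_intros)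
    ultimately have "((\<lambda>t. Re (\<omega> (1 + of_real t * v)) - norm (1 + of_real t * v))
        has_real_derivative Re (c * v) - Re v) (at 0)"
      by (rule DERIV_diff)
    from DERIV_pos_inc_right[OF this pos] obtain e where e: "e > 0"
      "\<And>h. 0 < h \<Longrightarrow> h < e \<Longrightarrow>
         Re (\<omega> (1 + of_real h * v)) > norm (1 + of_real h * v)"
      by (auto simp: \<omega>_def nz)
    have vn: "norm v > 0" using v by auto
    \<comment> \<open>The second entry ensures
      \<open>norm (1 + h * v)\<^sup>2 \<le> 1 + h * Re v < 1\<close>, so that Schwarz applies at
      this point.\<close>
    define h where "h = min (e / 2) (- Re v / (norm v)\<^sup>2)"
    have h: "h > 0" "h < e" using e(1) v vn by (auto simp: h_def min_less_iff_disj intro!: divide_neg_pos)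
    have "h * (norm v)\<^sup>2 \<le> - Re v"
      using vn by (simp add: h_def min_def field_simps)
    then have "h * (2 * Re v + h * (norm v)\<^sup>2) < 0"
      using h v by (intro mult_pos_neg) auto
    moreover have "(norm (1 + of_real h * v))\<^sup>2 = 1 + h * (2 * Re v + h * (norm v)\<^sup>2)"
      unfolding cmod_power2 by (simp add: power2_eq_square algebra_simps)
    ultimately have "(norm (1 + of_real h * v))\<^sup>2 < 1\<^sup>2" by simp
    then have "norm (1 + of_real h * v) < 1" by (rule power2_less_imp_less) simp
    from Schwarz[OF this] e(2)[OF h] show False
      using complex_Re_le_cmod[of "\<omega> (1 + of_real h * v)"] by linarith
  qed
  have "Im c = 0"
  proof (rule ccontr)
    assume "Im c \<noteq> 0"
    \<comment> \<open>This direction makes \<open>Re (c * v) = 0\<close> while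
      \<open>Re v = -1\<close>.\<close>
    with key[of "Complex (-1) (- Re c / Im c)"] show False by simp
  qed
  moreover have "Re c \<ge> 1" using key[of "-1"] by simp
  moreover have "z0 * d = c * w z0" using nz by (simp add: c_def)
  ultimately show ?thesis
    by (intro exI[of _ "Re c"]) (auto simp: complex_eq_iff)
qed

text \<open>Scaled so that \<open>U 1 = 1\<close>. It satisfies
  \<open>z U'(z) = 3/8 (3z - z^3) = 9/8 (phi_Ne z - 1)\<close>.\<close>

definition U :: "complex \<Rightarrow> complex" where
  "U z = (9 * z - z ^ 3) / 8"

lemma U_deriv: "(U has_field_derivative (9 - 3 * z\<^sup>2) / 8) (at z)"
  unfolding U_def by (auto intro!: derivative_eq_intros)

lemma U_holomorphic: "U holomorphic_on S"
  unfolding U_def by (intro holomorphic_intros) auto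

text \<open>The disk is larger than the unit disk so that the inverse of \<open>U\<close> is
  holomorphic across the boundary of the image of the unit disk. The radius is maximal, since
  \<open>U'\<close> vanishes at the square roots of 3.\<close>

lemma U_inj: "inj_on U (ball 0 (sqrt 3))"
proof (rule inj_onI, rule ccontr)
  fix a b assume ab: "a \<in> ball 0 (sqrt 3)" "b \<in> ball 0 (sqrt 3)" and eq: "U a = U b" and "a \<noteq> b"
  have "(a - b) * (9 - (a\<^sup>2 + a * b + b\<^sup>2)) = 0"
    using eq unfolding U_def
    by (simp only: divide_cancel_right) (simp add: power3_eq_cube power2_eq_square algebra_simps)
  with \<open>a \<noteq> b\<close> have 9: "9 = a\<^sup>2 + a * b + b\<^sup>2" by simp
  have n: "norm a * norm b < sqrt 3 * sqrt 3" if "norm a < sqrt 3" "norm b < sqrt 3" for a b :: complex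
    using that by (intro mult_strict_mono') auto
  have "9 = norm (a\<^sup>2 + a * b + b\<^sup>2)" unfolding 9[symmetric] by simp
  also have "\<dots> \<le> norm (a\<^sup>2) + norm (a * b) + norm (b\<^sup>2)"
    by (intro order_trans[OF norm_triangle_ineq] add_right_mono norm_triangle_ineq)
  also have "\<dots> < 3 + 3 + 3"
    using ab n[of a a] n[of a b] n[of b b] by (simp add: norm_mult norm_power power2_eq_square)
  finally show False by simp
qed

text \<open>At a first exit point \<open>f = U \<zeta>\<close> with \<open>\<zeta>\<close> on the
  unit circle. Jack's lemma for the composition of \<open>f\<close> with the inverse of
  \<open>U\<close> shows that \<open>z f'(z)\<close> is a multiple, with factor at least 1, of a
  point on the scaled nephroid, contrary to \<open>nephroid_boundary_multiple\<close>. The factor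
  \<open>t\<close> leaves room for constants \<open>\<beta>\<close> above the extremal one.\<close>

lemma first_exit:
  assumes holf: "f holomorphic_on ball 0 1" and f0: "f 0 = 0"
    and sub: "\<And>z. z \<in> ball 0 1 \<Longrightarrow>
      \<exists>t\<ge>1. \<exists>\<xi>\<in>ball 0 1. of_real t * (z * deriv f z) = 3 / 8 * (3 * \<xi> - \<xi> ^ 3)"
    and z1: "z1 \<in> ball 0 1"
  shows "f z1 \<in> U ` ball 0 1"
proof (rule ccontr)
  assume not: "f z1 \<notin> U ` ball 0 1"
  have one_less: "(1::real) < sqrt 3" by simp
  have ball3: "u \<in> ball 0 (sqrt 3)" if "norm u \<le> 1" for u :: complex
    using le_less_trans[OF that one_less] by simp
  have inj: "inj_on U (ball 0 1)"
    by (rule inj_on_subset[OF U_inj]) (auto intro!: ball3)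
  have opU: "open (U ` ball 0 1)"
    by (rule open_mapping_thm3[OF U_holomorphic _ inj]) simp
  have contf: "continuous_on (ball 0 1) f" by (rule holomorphic_on_imp_continuous_on[OF holf])
  \<comment> \<open>A point of least modulus in this compact set is the first exit; \<open>f\<close>
    maps all points of smaller modulus into the open image of \<open>U\<close>.\<close>
  define K where "K = cball 0 (norm z1) \<inter> f -` (- (U ` ball 0 1))"
  have cb: "cball 0 (norm z1) \<subseteq> ball (0::complex) 1" using z1 by auto
  have "closed K" unfolding K_def
    by (rule continuous_closed_preimage[OF continuous_on_subset[OF contf cb]]) (use opU in auto)
  then have "compact K" unfolding K_def by (simp add: compact_eq_bounded_closed bounded_Int)
  moreover have "K \<noteq> {}" using not by (auto simp: K_def)
  ultimately obtain z0 where z0: "z0 \<in> K" and min: "\<And>z. z \<in> K \<Longrightarrow> norm z0 \<le> norm z"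
    using continuous_attains_inf[of K norm] by (auto intro: continuous_intros)
  define r where "r = norm z0"
  have z0b: "z0 \<in> ball 0 1" using z0 cb by (auto simp: K_def)
  have inside: "f z \<in> U ` ball 0 1" if "norm z < r" for z
    using min[of z] that z0 by (auto simp: K_def r_def)
  have "f 0 = U 0" by (simp add: f0 U_def)
  then have "f 0 \<in> U ` ball 0 1" by simp
  then have "z0 \<noteq> 0" using z0 unfolding K_def by blast
  then have r: "r > 0" "r < 1" using z0b by (auto simp: r_def)
  have "f ` closure (ball 0 r) \<subseteq> U ` cball 0 1"
  proof (rule image_closure_subset)
    show "continuous_on (closure (ball 0 r)) f"
      using r by (intro continuous_on_subset[OF contf]) auto
    show "closed (U ` cball 0 1)"
      by (intro compact_imp_closed compact_continuous_image holomorphic_on_imp_continuous_on U_holomorphic) simp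
    show "f ` ball 0 r \<subseteq> U ` cball 0 1"
      using inside by fastforce
  qed
  then have "f z0 \<in> U ` cball 0 1" using r by (auto simp: r_def)
  then obtain \<zeta> where \<zeta>: "f z0 = U \<zeta>" "norm \<zeta> \<le> 1" by auto
  moreover have "\<not> norm \<zeta> < 1" using z0 \<zeta>(1) by (auto simp: K_def)
  ultimately have \<zeta>1: "norm \<zeta> = 1" by simp
  obtain g where holg: "g holomorphic_on U ` ball 0 (sqrt 3)"
    and dg: "\<And>z. z \<in> ball 0 (sqrt 3) \<Longrightarrow> deriv U z * deriv g (U z) = 1"
    and g: "\<And>z. z \<in> ball 0 (sqrt 3) \<Longrightarrow> g (U z) = z"
    using holomorphic_has_inverse[OF U_holomorphic _ U_inj] by auto
  have op3: "open (U ` ball 0 (sqrt 3))"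
    by (rule open_mapping_thm3[OF U_holomorphic _ U_inj]) simp
  have \<zeta>3: "\<zeta> \<in> ball 0 (sqrt 3)" using \<zeta>1 by (intro ball3) simp
  have "\<exists>m\<ge>1. z0 * (deriv g (f z0) * deriv f z0) = of_real m * (g \<circ> f) z0"
  proof (rule Jack[of _ r])
    show "g \<circ> f holomorphic_on ball 0 r"
    proof (rule holomorphic_on_compose_gen[OF _ holg])
      show "f holomorphic_on ball 0 r" using r by (intro holomorphic_on_subset[OF holf]) auto
      show "f ` ball 0 r \<subseteq> U ` ball 0 (sqrt 3)" 
        using inside ball3 by (fastforce simp: less_imp_le)
    qed
    show "(g \<circ> f) 0 = 0" using g[of 0] by (simp add: f0 U_def)
    show "norm ((g \<circ> f) z) < 1" if z: "norm z < r" for z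
    proof -
      obtain u where "f z = U u" "norm u < 1" using inside[OF z] by auto
      then show ?thesis using g[OF ball3, of u] by simp
    qed
    show "norm ((g \<circ> f) z0) = 1" using g[OF \<zeta>3] \<zeta> \<zeta>1 by simp
    have "(g has_field_derivative deriv g (f z0)) (at (f z0))"
      using holomorphic_derivI[OF holg op3] \<zeta>(1) \<zeta>3 by auto
    moreover have "(f has_field_derivative deriv f z0) (at z0)"
      using holomorphic_derivI[OF holf _ z0b] by simp
    ultimately show "(g \<circ> f has_field_derivative deriv g (f z0) * deriv f z0) (at z0)"
      by (rule DERIV_chain)
  qed (use r in \<open>auto simp: r_def\<close>)
  then obtain m where m: "m \<ge> 1" "z0 * (deriv g (f z0) * deriv f z0) = of_real m * \<zeta>"
    using g[OF \<zeta>3] \<zeta>(1) by auto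
  have "z0 * deriv f z0 = deriv U \<zeta> * (z0 * (deriv g (f z0) * deriv f z0))"
    using dg[OF \<zeta>3] by (simp add: \<zeta>(1) algebra_simps)
  also have "\<dots> = of_real m * (3 / 8 * (3 * \<zeta> - \<zeta> ^ 3))"
    unfolding m(2) DERIV_imp_deriv[OF U_deriv]
    by (simp add: power3_eq_cube power2_eq_square field_simps)
  finally have eq: "z0 * deriv f z0 = of_real m * (3 / 8 * (3 * \<zeta> - \<zeta> ^ 3))" .
  obtain t \<xi> where t: "t \<ge> 1" and \<xi>: "norm \<xi> < 1"
    and "of_real t * (z0 * deriv f z0) = 3 / 8 * (3 * \<xi> - \<xi> ^ 3)"
    using sub[OF z0b] by auto
  then have "3 / 8 * (of_real (t * m) * (3 * \<zeta> - \<zeta> ^ 3)) = 3 / 8 * (3 * \<xi> - \<xi> ^ 3)"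
    unfolding eq by (simp only: of_real_mult mult_ac)
  then have "of_real (t * m) * (3 * \<zeta> - \<zeta> ^ 3) = 3 * \<xi> - \<xi> ^ 3"
    by (subst (asm) mult_cancel_left) simp
  moreover have "t * m \<ge> 1" using t m(1) mult_mono[of 1 t 1 m] by simp
  ultimately show False using nephroid_boundary_multiple[OF \<xi> \<zeta>1] by blast
qed

text \<open>Both bounds are the exact values at the points of the unit circle with the same real
  part as \<open>z\<close>.\<close>

lemma U_bounds:
  assumes z: "z \<in> ball 0 1" and x: "x = \<bar>Re z\<bar>"
  shows "\<bar>Re (U z)\<bar> \<le> x * (3 - x\<^sup>2) / 2" "(norm (U z))\<^sup>2 \<le> (25 - 9 * x\<^sup>2) / 16" "0 \<le> x" "x < 1"
proof -
  define a b where "a = Re z" "b = (Im z)\<^sup>2"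
  have r: "a\<^sup>2 + b < 1" "b \<ge> 0"
    using z by (auto simp: a_b_def cmod_def)
  have xa: "\<bar>a\<bar> = x" "a\<^sup>2 = x\<^sup>2" using x by (auto simp: a_b_def)
  show x0: "0 \<le> x" and "x < 1"
    using x z abs_Re_le_cmod[of z] by (auto simp del: abs_Re_le_cmod)
  have "Re (U z) = a * (9 - a\<^sup>2 + 3 * b) / 8"
    by (simp add: U_def a_b_def power3_eq_cube power2_eq_square algebra_simps)
  then have "\<bar>Re (U z)\<bar> = x * \<bar>9 - a\<^sup>2 + 3 * b\<bar> / 8"
    by (simp only: abs_divide abs_mult xa(1) abs_numeral)
  also have "\<bar>9 - a\<^sup>2 + 3 * b\<bar> \<le> 4 * (3 - x\<^sup>2)"
    using r xa by simp
  finally show "\<bar>Re (U z)\<bar> \<le> x * (3 - x\<^sup>2) / 2"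
    using x0 by (simp add: mult_left_mono right_diff_distrib)
  define R where "R = a\<^sup>2 + b"
  have "(norm (U z))\<^sup>2 = R * (81 - 18 * a\<^sup>2 + 18 * b + R\<^sup>2) / 64"
    unfolding cmod_power2 U_def R_def
    by (simp add: a_b_def power3_eq_cube power2_eq_square field_simps)
  also have "\<dots> \<le> 1 * (81 - 18 * a\<^sup>2 + 18 * (1 - a\<^sup>2) + 1) / 64"
  proof -
    have "R \<ge> 0" "R \<le> 1" "a\<^sup>2 \<le> 1" using r by (auto simp: R_def)
    moreover have "R\<^sup>2 \<le> 1" using \<open>R \<ge> 0\<close> \<open>R \<le> 1\<close> by (simp add: power_le_one)
    ultimately show ?thesis using r
      by (intro divide_right_mono mult_mono) auto
  qed
  finally show "(norm (U z))\<^sup>2 \<le> (25 - 9 * x\<^sup>2) / 16" by (simp add: xa)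
qed

text \<open>A strip and the disk of radius \<open>5/4 = norm (U \<i>)\<close>. This crude
  information suffices for all superordinates except the exponential and the sine.\<close>

lemma U_strip:
  assumes "z \<in> ball 0 1"
  shows "\<bar>Re (U z)\<bar> < 1" "(norm (U z))\<^sup>2 \<le> 25 / 16"
proof -
  define x where "x = \<bar>Re z\<bar>"
  note b = U_bounds[OF assms x_def]
  have "2 - x * (3 - x\<^sup>2) = (1 - x)\<^sup>2 * (2 + x)"
    by (simp add: power2_eq_square algebra_simps)
  also have "\<dots> > 0" using b by simp
  finally show "\<bar>Re (U z)\<bar> < 1" using b(1) by simp
  show "(norm (U z))\<^sup>2 \<le> 25 / 16" by (rule order_trans[OF b(2)]) simp
qed

text \<open>On the unit circle, \<open>|U|\<^sup>2 - 1\<close> has order \<open>(Im U)\<^sup>2\<close> near \<open>\<plusminus>1\<close>, so this quantifies that the vertical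
  tangents of \<open>U(\<D>)\<close> at \<open>\<plusminus>1\<close> are approached only to fourth order. The constant is optimal.\<close>

lemma U_flat:
  assumes "z \<in> ball 0 1" "(norm (U z))\<^sup>2 \<ge> 1"
  shows "32 / 27 * ((norm (U z))\<^sup>2 - 1)\<^sup>2 \<le> 1 - \<bar>Re (U z)\<bar>"
proof -
  define x where "x = \<bar>Re z\<bar>"
  note b = U_bounds[OF assms(1) x_def]
  have "((norm (U z))\<^sup>2 - 1)\<^sup>2 \<le> (9 * (1 - x\<^sup>2) / 16)\<^sup>2"
    using b(2) assms(2) by (intro power_mono) auto
  then have "32 / 27 * ((norm (U z))\<^sup>2 - 1)\<^sup>2 \<le> 32 / 27 * (9 * (1 - x\<^sup>2) / 16)\<^sup>2"
    by simp
  \<comment> \<open>Both \<open>1 - x * (3 - x\<^sup>2) / 2\<close> and the multiple of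
    \<open>(1 - x\<^sup>2)\<^sup>2\<close> contain \<open>(1 - x)\<^sup>2\<close>; the constant
    32/27 makes their difference gain a third factor \<open>1 - x\<close>.\<close>
  also have "\<dots> = 1 - x * (3 - x\<^sup>2) / 2 - (1 - x) ^ 3 * (5 + 3 * x) / 8"
    by (simp add: power2_eq_square power3_eq_cube field_simps)
  also have "\<dots> \<le> 1 - x * (3 - x\<^sup>2) / 2" using b by simp
  also have "\<dots> \<le> 1 - \<bar>Re (U z)\<bar>" using b(1) by simp
  finally show ?thesis .
qed

section \<open>Reduction to boundary values\<close>

text \<open>The image of \<open>p\<close> is connected and misses \<open>P\<close> of the circle. It
  is therefore covered by two disjoint open sets, the image of the open disk under \<open>P\<close>
  and the complement of that of the closed disk. It meets the first at \<open>P 0\<close>, hence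
  lies in it, and \<open>w\<close> is the inverse of \<open>P\<close> after
  \<open>p\<close>.\<close>

lemma subordinateI:
  assumes holp: "p holomorphic_on ball 0 1" and holP: "P holomorphic_on ball 0 1"
    and contP: "continuous_on (cball 0 1) P" and inj: "inj_on P (ball 0 1)"
    and 0: "p 0 = P 0"
    and avoid: "\<And>z \<zeta>. z \<in> ball 0 1 \<Longrightarrow> norm \<zeta> = 1 \<Longrightarrow> p z \<noteq> P \<zeta>"
  shows "subordinate p P"
proof -
  have contp: "continuous_on (ball 0 1) p" by (rule holomorphic_on_imp_continuous_on[OF holp])
  have op: "open (P ` ball 0 1)" by (rule open_mapping_thm3[OF holP _ inj]) simp
  have cl: "closed (P ` cball 0 1)"
    by (intro compact_imp_closed compact_continuous_image contP) simp
  have conn: "connected (p ` ball 0 1)"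
    by (intro connected_continuous_image contp) simp
  have cases: "norm \<zeta> < 1 \<or> norm \<zeta> = 1" if "\<zeta> \<in> cball 0 1" for \<zeta> :: complex
    using that by auto
  have sub: "p ` ball 0 1 \<subseteq> P ` ball 0 1"
  proof (rule ccontr)
    assume not: "\<not> p ` ball 0 1 \<subseteq> P ` ball 0 1"
    have *: "v \<in> P ` ball 0 1" if "v \<in> P ` cball 0 1" "v \<in> p ` ball 0 1" for v
      using that avoid cases by fastforce
    have "P ` ball 0 1 \<inter> p ` ball 0 1 \<noteq> {}"
      using 0 by (metis IntI centre_in_ball empty_iff imageI zero_less_one)
    moreover have "- (P ` cball 0 1) \<inter> p ` ball 0 1 \<noteq> {}" using not * by blast
    moreover have "p ` ball 0 1 \<subseteq> P ` ball 0 1 \<union> - (P ` cball 0 1)" using * by auto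
    moreover have "P ` ball 0 1 \<inter> - (P ` cball 0 1) \<inter> p ` ball 0 1 = {}" by auto
    moreover have "open (- (P ` cball 0 1))" using cl by auto
    ultimately show False using conn op unfolding connected_def by blast
  qed
  obtain g where holg: "g holomorphic_on P ` ball 0 1"
    and g: "\<And>z. z \<in> ball 0 1 \<Longrightarrow> g (P z) = z"
    using holomorphic_has_inverse[OF holP _ inj] by (metis open_ball)
  have "g \<circ> p holomorphic_on ball 0 1"
    by (rule holomorphic_on_compose_gen[OF holp holg sub])
  then have "g \<circ> p analytic_on ball 0 1" by (simp add: analytic_on_open)
  moreover have "norm ((g \<circ> p) z) < 1 \<and> p z = P ((g \<circ> p) z)" if z: "z \<in> ball 0 1" for z
  proof -
    obtain v where v: "v \<in> ball 0 1" "p z = P v" using sub z by blast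
    then show ?thesis using g[OF v(1)] by simp
  qed
  moreover have "(g \<circ> p) 0 = 0" using g[of 0] 0 by simp
  ultimately show ?thesis unfolding subordinate_def by (intro exI[of _ "g \<circ> p"]) blast
qed

text \<open>For \<open>f = (p - 1) / s\<close> the hypothesis places \<open>t z f'(z)\<close> in the
  scaled nephroid domain with \<open>t = 9 * s * \<beta> / 8\<close>; the bound on
  \<open>\<beta>\<close> says exactly \<open>t \<ge> 1\<close>.\<close>

lemma admissible_imp_range:
  assumes adm: "admissible \<beta> p" and \<beta>: "\<beta> \<ge> 8 / (9 * s)" and s: "s > 0" and z: "z \<in> ball 0 1"
  shows "\<exists>u\<in>ball 0 1. p z = 1 + of_real s * U u"
proof -
  have holp: "p holomorphic_on ball 0 1" and p0: "p 0 = 1"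
    using adm by (auto simp: admissible_def analytic_on_open)
  obtain w where w: "\<And>z. z \<in> ball 0 1 \<Longrightarrow> norm (w z) < 1"
    "\<And>z. z \<in> ball 0 1 \<Longrightarrow> 1 + of_real \<beta> * z * deriv p z = phi_Ne (w z)"
    using adm unfolding admissible_def subordinate_def by blast
  define f where "f z = (p z - 1) / of_real s" for z
  have holf: "f holomorphic_on ball 0 1"
    unfolding f_def using s by (intro holomorphic_intros holp) auto
  have df: "deriv f z = deriv p z / of_real s" if "z \<in> ball 0 1" for z
  proof (rule DERIV_imp_deriv)
    have "(p has_field_derivative deriv p z) (at z)"
      using holomorphic_derivI[OF holp _ that] by simp
    then show "(f has_field_derivative deriv p z / of_real s) (at z)"
      unfolding f_def using s by (auto intro!: derivative_eq_intros)
  qed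
  have "f z \<in> U ` ball 0 1"
  proof (rule first_exit[OF holf])
    show "f 0 = 0" by (simp add: f_def p0)
    fix z :: complex assume z: "z \<in> ball 0 1"
    have "of_real (9 * s * \<beta> / 8) * (z * deriv f z) = 9 / 8 * (of_real \<beta> * z * deriv p z)"
      using s by (simp add: df[OF z])
    also have "of_real \<beta> * z * deriv p z = w z - w z ^ 3 / 3"
      using w(2)[OF z] by (simp add: phi_Ne_def algebra_simps)
    also have "9 / 8 * \<dots> = 3 / 8 * (3 * w z - w z ^ 3)" by (simp add: algebra_simps)
    finally have "of_real (9 * s * \<beta> / 8) * (z * deriv f z) = 3 / 8 * (3 * w z - w z ^ 3)" .
    moreover have "9 * s * \<beta> / 8 \<ge> 1" using \<beta> s by (simp add: field_simps)
    ultimately show "\<exists>t\<ge>1. \<exists>\<xi>\<in>ball 0 1. of_real t * (z * deriv f z) = 3 / 8 * (3 * \<xi> - \<xi> ^ 3)"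
      using w(1)[OF z] by (intro exI[of _ "9 * s * \<beta> / 8"] conjI bexI[of _ "w z"]) auto
  qed (rule z)
  then show ?thesis using s by (auto simp: f_def field_simps)
qed

text \<open>For sharpness take the \<open>p\<close> with
  \<open>1 + \<beta> z p'(z) = phi_Ne z\<close>, that is, \<open>1 + 8/(9 \<beta>) U\<close>. If
  \<open>\<beta> < b\<close>, then on the negative radius it takes values
  \<open>1 - \<sigma>\<close> with \<open>\<sigma> > s\<close>, which \<open>P\<close>
  omits.\<close>

lemma sharp_boundI:
  assumes s: "s > 0" and b: "b = 8 / (9 * s)"
    and valid: "\<And>p. p holomorphic_on ball 0 1 \<Longrightarrow> p 0 = 1 \<Longrightarrow>
      (\<And>z. z \<in> ball 0 1 \<Longrightarrow> \<exists>u\<in>ball 0 1. p z = 1 + of_real s * U u) \<Longrightarrow> subordinate p P"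
    and s1: "s < s1"
    and sharp: "\<And>\<sigma> z. s < \<sigma> \<Longrightarrow> \<sigma> < s1 \<Longrightarrow> norm z < 1 \<Longrightarrow> P z \<noteq> 1 - of_real \<sigma>"
  shows "sharp_bound b P"
  unfolding sharp_bound_def
proof (intro conjI allI impI)
  show "valid_bound b P"
    unfolding valid_bound_def
  proof (intro allI impI)
    fix \<beta> p assume \<beta>: "b \<le> \<beta>" and adm: "admissible \<beta> p"
    then show "subordinate p P"
      using admissible_imp_range[OF adm \<beta>[unfolded b] s]
      by (intro valid) (auto simp: admissible_def analytic_on_open)
  qed
next
  fix b' assume b': "b' < b"
  \<comment> \<open>\<open>valid_bound b'\<close> speaks about every larger constant as well, so
    \<open>b'\<close> may be raised: this keeps \<open>\<beta>\<close> positive and the values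
    \<open>\<sigma>\<close> below \<open>s1\<close>.\<close>
  define \<beta> where "\<beta> = max b' (8 / (9 * s1))"
  have "8 / (9 * s1) < b" using s s1 by (simp add: b divide_strict_left_mono)
  then have \<beta>: "b' \<le> \<beta>" "\<beta> < b" "\<beta> \<ge> 8 / (9 * s1)" "\<beta> > 0"
    using b' s s1 by (auto simp: \<beta>_def less_max_iff_disj)
  define p :: "complex \<Rightarrow> complex" where "p z = 1 + (z - z ^ 3 / 9) / of_real \<beta>" for z
  have dp: "deriv p z = (1 - z\<^sup>2 / 3) / of_real \<beta>" for z
    unfolding p_def using \<beta>(4)
    by (intro DERIV_imp_deriv) (auto intro!: derivative_eq_intros)
  have "p analytic_on ball 0 1"
    unfolding p_def using \<beta>(4) by (intro analytic_intros) auto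
  moreover have "subordinate (\<lambda>z. 1 + of_real \<beta> * z * deriv p z) phi_Ne"
    unfolding subordinate_def using \<beta>(4)
    by (intro exI[of _ "\<lambda>z. z"])
      (auto simp: dp phi_Ne_def power3_eq_cube power2_eq_square field_simps)
  ultimately have adm: "admissible \<beta> p" by (auto simp: admissible_def p_def)
  show "\<not> valid_bound b' P"
  proof
    assume "valid_bound b' P"
    then have "subordinate p P" using adm \<beta>(1) by (auto simp: valid_bound_def)
    then obtain w where w: "\<And>z. z \<in> ball 0 1 \<Longrightarrow> norm (w z) < 1 \<and> p z = P (w z)"
      unfolding subordinate_def by blast
    \<comment> \<open>Here \<open>\<sigma> = (r - r ^ 3 / 9) / \<beta>\<close> belongs to the point
      \<open>-r\<close>. Its limit \<open>8 / (9 * \<beta>)\<close> exceeds \<open>s\<close>, so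
      some \<open>r < 1\<close> already gives \<open>\<sigma> > s\<close>.\<close>
    have "((\<lambda>r. (r - r ^ 3 / 9) / \<beta>) \<longlongrightarrow> (1 - 1 ^ 3 / 9) / \<beta>) (at_left 1)"
      using \<beta>(4) by (intro tendsto_intros) auto
    moreover have "s < (1 - 1 ^ 3 / 9) / \<beta>" using \<beta> s by (simp add: b field_simps)
    ultimately have "\<forall>\<^sub>F r in at_left 1. s < (r - r ^ 3 / 9) / \<beta>"
      by (rule order_tendstoD(1))
    moreover have "\<forall>\<^sub>F r in at_left (1::real). r \<in> {0<..<1}"
      by (rule eventually_at_left_real) simp
    ultimately have "\<forall>\<^sub>F r in at_left 1. s < (r - r ^ 3 / 9) / \<beta> \<and> r \<in> {0<..<1}"
      by (rule eventually_conj)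
    then obtain r where r: "s < (r - r ^ 3 / 9) / \<beta>" "0 < r" "r < 1"
      using eventually_happens[of _ "at_left (1::real)"] by (auto simp: trivial_limit_at_left_real)
    have "(1 - r) * (8 - r - r\<^sup>2) > 0"
      using r power_le_one[of r 2] by (intro mult_pos_pos) auto
    then have "r - r ^ 3 / 9 < 8 / 9"
      by (simp add: power3_eq_cube power2_eq_square algebra_simps)
    then have "(r - r ^ 3 / 9) / \<beta> < 8 / 9 / \<beta>" using \<beta>(4) by (intro divide_strict_right_mono)
    also have "\<dots> \<le> s1" using \<beta>(3,4) s s1 by (simp add: field_simps)
    finally have "P (w (- of_real r)) \<noteq> 1 - of_real ((r - r ^ 3 / 9) / \<beta>)"
      using r w[of "- of_real r"] by (intro sharp) auto
    moreover have "p (- of_real r) = 1 - of_real ((r - r ^ 3 / 9) / \<beta>)"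
      by (simp add: p_def power3_eq_cube minus_divide_left[symmetric] diff_divide_distrib)
    ultimately show False using w[of "- of_real r"] r by simp
  qed
qed

lemma sharp_boundI_univalent:
  assumes "s > 0" "b = 8 / (9 * s)" "P holomorphic_on ball 0 1" "continuous_on (cball 0 1) P"
    "inj_on P (ball 0 1)" "P 0 = 1"
    and avoid: "\<And>u \<zeta>. u \<in> ball 0 1 \<Longrightarrow> norm \<zeta> = 1 \<Longrightarrow> P \<zeta> \<noteq> 1 + of_real s * U u"
    and "s < s1" "\<And>\<sigma> z. s < \<sigma> \<Longrightarrow> \<sigma> < s1 \<Longrightarrow> norm z < 1 \<Longrightarrow> P z \<noteq> 1 - of_real \<sigma>"
  shows "sharp_bound b P"
proof (rule sharp_boundI)
  fix p :: "complex \<Rightarrow> complex"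
  assume "p holomorphic_on ball 0 1" "p 0 = 1"
    and rng: "\<And>z. z \<in> ball 0 1 \<Longrightarrow> \<exists>u\<in>ball 0 1. p z = 1 + of_real s * U u"
  moreover have "p z \<noteq> P \<zeta>" if "z \<in> ball 0 1" "norm \<zeta> = 1" for z \<zeta>
    using rng[OF that(1)] avoid[OF _ that(2)] by force
  ultimately show "subordinate p P"
    using assms(3-6) by (intro subordinateI) auto
qed (use assms in auto)

lemma sqrt_2_bounds: "141 / 100 < sqrt 2" "sqrt 2 < 142 / 100"
proof -
  show "141 / 100 < sqrt 2" by (rule real_less_rsqrt) (simp add: power2_eq_square)
  show "sqrt 2 < 142 / 100" by (rule real_less_lsqrt) (simp_all add: power2_eq_square)
qed

lemma sphere_Re_Im:
  assumes "norm (z :: complex) = 1"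
  shows "(Im z)\<^sup>2 = 1 - (Re z)\<^sup>2" "-1 \<le> Re z" "Re z \<le> 1"
  using assms abs_Re_le_cmod[of z] by (auto simp: cmod_def)

lemma disk_Re_Im:
  assumes "norm (z :: complex) < 1"
  shows "(Re z)\<^sup>2 + (Im z)\<^sup>2 < 1" "-1 < Re z" "Re z < 1"
proof -
  show "(Re z)\<^sup>2 + (Im z)\<^sup>2 < 1" using assms by (simp add: cmod_def)
  show "-1 < Re z" "Re z < 1" using assms abs_Re_le_cmod[of z] by linarith+
qed

section \<open>Algebraic superordinates\<close>

text \<open>Here \<open>P (-1) = sqrt 2 - 1\<close>. Instead of boundary values, explicit
  inequalities describing the crescent are checked on the range of \<open>p\<close>, and the inverse
  of \<open>P\<close> is written down.\<close>

lemma sharp_crescent: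
  "sharp_bound (4 / 9 * (2 + sqrt 2)) (\<lambda>z. csqrt (1 + z ^ 2) + z)"
proof (rule sharp_boundI)
  define s where "s = 2 - sqrt 2"
  have s: "1 / 2 < s" "s < 3 / 5" "(2 - s)\<^sup>2 = 2" using sqrt_2_bounds by (auto simp: s_def)
  fix p assume holp: "p holomorphic_on ball 0 1" and p0: "p 0 = 1"
    and rng: "\<And>z. z \<in> ball 0 1 \<Longrightarrow> \<exists>u\<in>ball 0 1. p z = 1 + of_real (2 - sqrt 2) * U u"
  \<comment> \<open>The crescent is the difference of the disks of radius \<open>\<surd>2\<close> around \<open>1\<close> and \<open>-1\<close>.\<close>
  have key: "Re (p z) > 0 \<and> norm ((p z)\<^sup>2 - 1) < 2 * norm (p z)" if z: "z \<in> ball 0 1" for z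
  proof -
    obtain u where u: "u \<in> ball 0 1" and pz: "p z = 1 + of_real s * U u"
      using rng[OF z] by (auto simp: s_def)
    define a b t X where "a = Re (p z)" "b = Im (p z)" "t = norm (U u)" "X = Re (U u)"
    have X: "\<bar>X\<bar> < 1" and t: "t\<^sup>2 \<le> 25 / 16" and Xt: "X \<ge> - t" "t \<ge> 0"
      using U_strip[OF u] abs_Re_le_cmod[of "U u"] by (auto simp: a_b_t_X_def simp del: abs_Re_le_cmod)
    have a: "a = 1 + s * X" by (simp add: a_b_t_X_def pz)
    have ab: "(a - 1)\<^sup>2 + b\<^sup>2 = s\<^sup>2 * t\<^sup>2"
      by (simp add: a_b_t_X_def pz cmod_power2) (simp add: power2_eq_square algebra_simps)
    have "s * X > s * (-1)" using X s by (intro mult_strict_left_mono) auto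
    then have "a > 0" using a s by simp
    have "s\<^sup>2 * t\<^sup>2 \<le> 1 * (25 / 16)"
      using s t by (intro mult_mono) (auto simp: power_le_one)
    then have "s\<^sup>2 * t\<^sup>2 < 2" by simp
    moreover have "(a + 1)\<^sup>2 + b\<^sup>2 > 2"
    proof -
      \<comment> \<open>Expansion about the touching point \<open>1 - s\<close>, which lies on the
        circle around -1 since \<open>(2 - s)\<^sup>2 = 2\<close>. The rest is positive by
        \<open>X \<ge> -t\<close> inside the unit disk and by \<open>X > -1\<close> outside
        it.\<close>
      have "(a + 1)\<^sup>2 + b\<^sup>2 = (2 - s)\<^sup>2 + s * (4 * (1 + X) + s * (t\<^sup>2 - 1))"
        using ab unfolding a by (simp add: power2_eq_square algebra_simps)
      moreover have "4 * (1 + X) + s * (t\<^sup>2 - 1) > 0"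
      proof (cases "t < 1")
        case True
        have "s * (1 + t) < 1 * 2" using s True Xt by (intro mult_strict_mono) auto
        then have "0 < (1 - t) * (4 - s * (1 + t))" using True by simp
        also have "\<dots> \<le> 4 * (1 + X) + s * (t\<^sup>2 - 1)"
          using Xt by (simp add: power2_eq_square algebra_simps)
        finally show ?thesis .
      next
        case False
        then show ?thesis using X s by (intro add_pos_nonneg) auto
      qed
      ultimately show ?thesis using s by simp
    qed
    ultimately have "((a - 1)\<^sup>2 + b\<^sup>2 - 2) * ((a + 1)\<^sup>2 + b\<^sup>2 - 2) < 0"
      unfolding ab by (intro mult_neg_pos) auto
    \<comment> \<open>With \<open>q = p z\<close> this is
      \<open>|q^2 - 1|^2 - 4|q|^2 = (|q - 1|^2 - 2)(|q + 1|^2 - 2)\<close>, negative exactly when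
      \<open>q\<close> lies in one of the two disks but not in the closure of the other, or vice
      versa.\<close>
    moreover have "(norm ((p z)\<^sup>2 - 1))\<^sup>2
        = ((a - 1)\<^sup>2 + b\<^sup>2 - 2) * ((a + 1)\<^sup>2 + b\<^sup>2 - 2) + (2 * norm (p z))\<^sup>2"
      unfolding power_mult_distrib cmod_power2
      by (simp add: a_b_t_X_def) (simp add: power2_eq_square algebra_simps)
    ultimately have "(norm ((p z)\<^sup>2 - 1))\<^sup>2 < (2 * norm (p z))\<^sup>2" by simp
    then have "norm ((p z)\<^sup>2 - 1) < 2 * norm (p z)" by (rule power2_less_imp_less) simp
    with \<open>a > 0\<close> show ?thesis by (simp add: a_b_t_X_def)
  qed
  then have nz: "p z \<noteq> 0" if "z \<in> ball 0 1" for z using that by fastforce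
  \<comment> \<open>The inverse of \<open>\<surd>(1 + z\<^sup>2) + z\<close> is a Joukowski map.\<close>
  define w where "w z = ((p z)\<^sup>2 - 1) / (2 * p z)" for z
  have "w holomorphic_on ball 0 1"
    unfolding w_def using nz by (intro holomorphic_intros holp) auto
  then have "w analytic_on ball 0 1" by (simp add: analytic_on_open)
  moreover have "norm (w z) < 1 \<and> p z = csqrt (1 + (w z)\<^sup>2) + w z" if z: "z \<in> ball 0 1" for z
  proof
    show "norm (w z) < 1" using key[OF z] nz[OF z] by (simp add: w_def norm_divide norm_mult)
    have "1 + (w z)\<^sup>2 = ((p z + inverse (p z)) / 2)\<^sup>2"
      using nz[OF z] by (simp add: w_def power2_eq_square field_simps)
    moreover have "csqrt (((p z + inverse (p z)) / 2)\<^sup>2) = (p z + inverse (p z)) / 2"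
      using key[OF z] nz[OF z] by (intro csqrt_square disjI1) (auto intro!: add_pos_nonneg)
    ultimately have "csqrt (1 + (w z)\<^sup>2) = (p z + inverse (p z)) / 2" by simp
    then show "p z = csqrt (1 + (w z)\<^sup>2) + w z"
      using nz[OF z] by (simp add: w_def power2_eq_square field_simps)
  qed
  moreover have "w 0 = 0" by (simp add: w_def p0)
  ultimately show "subordinate p (\<lambda>z. csqrt (1 + z\<^sup>2) + z)"
    unfolding subordinate_def by blast
next
  fix \<sigma> :: real and z :: complex
  assume \<sigma>: "2 - sqrt 2 < \<sigma>" "\<sigma> < 1" and z: "norm z < 1"
  show "csqrt (1 + z\<^sup>2) + z \<noteq> 1 - of_real \<sigma>"
  proof
    \<comment> \<open>Squaring gives \<open>2 * c * z = c\<^sup>2 - 1\<close>, so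
      \<open>norm z < 1\<close> forces \<open>(c + 1)\<^sup>2 > 2\<close>, whereas
      \<open>0 < c < sqrt 2 - 1\<close>.\<close>
    define c where "c = 1 - \<sigma>"
    assume "csqrt (1 + z\<^sup>2) + z = 1 - of_real \<sigma>"
    then have "csqrt (1 + z\<^sup>2) = of_real c - z" by (simp add: c_def algebra_simps)
    then have "1 + z\<^sup>2 = (of_real c - z)\<^sup>2" by (metis power2_csqrt)
    then have "of_real (2 * c) * z = of_real (c\<^sup>2 - 1)"
      by (simp add: power2_eq_square algebra_simps)
    then have "2 * \<bar>c\<bar> * norm z = \<bar>c\<^sup>2 - 1\<bar>"
      by (metis norm_mult norm_of_real abs_mult abs_numeral)
    moreover have "2 * \<bar>c\<bar> * norm z < 2 * \<bar>c\<bar> * 1"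
      using z \<sigma> by (intro mult_strict_left_mono) (auto simp: c_def)
    ultimately have "2 < (c + 1)\<^sup>2" using \<sigma>
      by (simp add: c_def abs_if power2_eq_square algebra_simps split: if_splits)
    moreover have "(c + 1)\<^sup>2 < (sqrt 2)\<^sup>2"
      using \<sigma> by (intro power_strict_mono) (auto simp: c_def)
    ultimately show False by simp
  qed
qed (use sqrt_2_bounds in \<open>auto simp: field_simps\<close>)

lemma two_plus_nz:
  assumes "norm (x :: complex) < 1" "norm y < 1" "c \<ge> 2"
  shows "of_real c + x + y \<noteq> 0"
  using assms disk_Re_Im[of x] disk_Re_Im[of y] by (auto simp: complex_eq_iff)

text \<open>At a common point, \<open>norm (U u)\<^sup>2 = 5 + 4 * x\<close> is at most 25/16 only
  for \<open>x < 0\<close>; then \<open>Re (U u) = 2 * x * (1 + x) - 1\<close> is at most -1,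
  outside the strip.\<close>

lemma sharp_cardioid:
  "sharp_bound (4 / 3) (\<lambda>z. 1 + 4 / 3 * z + 2 / 3 * z ^ 2)"
proof (rule sharp_boundI_univalent[where s = "2 / 3" and ?s1.0 = 1])
  show "inj_on (\<lambda>z::complex. 1 + 4 / 3 * z + 2 / 3 * z ^ 2) (ball 0 1)"
  proof (rule inj_onI)
    fix x y :: complex assume xy: "x \<in> ball 0 1" "y \<in> ball 0 1"
      and eq: "1 + 4 / 3 * x + 2 / 3 * x ^ 2 = 1 + 4 / 3 * y + 2 / 3 * y ^ 2"
    have "(x - y) * (2 + x + y) =
        3 / 2 * ((1 + 4 / 3 * x + 2 / 3 * x ^ 2) - (1 + 4 / 3 * y + 2 / 3 * y ^ 2))"
      by (simp add: power2_eq_square field_simps)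
    then have "(x - y) * (2 + x + y) = 0" unfolding eq by simp
    then show "x = y" using two_plus_nz[of x y 2] xy by auto
  qed
  fix u \<zeta> :: complex assume u: "u \<in> ball 0 1" and \<zeta>: "norm \<zeta> = 1"
  define x where "x = Re \<zeta>"
  note xy = sphere_Re_Im[OF \<zeta>, folded x_def]
  show "1 + 4 / 3 * \<zeta> + 2 / 3 * \<zeta>\<^sup>2 \<noteq> 1 + of_real (2 / 3) * U u"
  proof
    assume h: "1 + 4 / 3 * \<zeta> + 2 / 3 * \<zeta>\<^sup>2 = 1 + of_real (2 / 3) * U u"
    have "\<zeta> * (2 + \<zeta>) = 3 / 2 * (1 + 4 / 3 * \<zeta> + 2 / 3 * \<zeta>\<^sup>2 - 1)"
      by (simp add: power2_eq_square field_simps)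
    then have eq: "U u = \<zeta> * (2 + \<zeta>)" unfolding h by simp
    have "(norm (U u))\<^sup>2 = 5 + 4 * x"
      unfolding eq norm_mult \<zeta> using xy
      by (simp add: cmod_power2 x_def) (simp add: power2_eq_square algebra_simps)
    then have "x < 0" using U_strip(2)[OF u] by simp
    then have "2 * x * (1 + x) \<le> 0" using xy by (simp add: mult_nonpos_nonneg)
    moreover have "Re (U u) = 2 * x * (1 + x) - 1"
      unfolding eq using xy(1) by (simp add: x_def power2_eq_square algebra_simps)
    ultimately show False using U_strip(1)[OF u] by simp
  qed
next
  fix \<sigma> :: real and z :: complex assume \<sigma>: "2 / 3 < \<sigma>" and z: "norm z < 1"
  show "1 + 4 / 3 * z + 2 / 3 * z\<^sup>2 \<noteq> 1 - of_real \<sigma>"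
  proof
    assume "1 + 4 / 3 * z + 2 / 3 * z\<^sup>2 = 1 - of_real \<sigma>"
    then have eq: "(1 + z)\<^sup>2 = of_real (1 - 3 / 2 * \<sigma>)"
      by (simp add: power2_eq_square field_simps)
    from arg_cong[OF eq, of Im] have "Im z = 0" using disk_Re_Im[OF z] by (simp add: Im_power2)
    with arg_cong[OF eq, of Re] have "(1 + Re z)\<^sup>2 = 1 - 3 / 2 * \<sigma>" by (simp add: Re_power2)
    then show False using \<sigma> zero_le_power2[of "1 + Re z"] by linarith
  qed
qed (auto intro!: holomorphic_intros continuous_intros)

text \<open>The strip condition factors as \<open>(1 + x) * (sqrt 2 - 1 + x) > 0\<close>, giving
  \<open>x > 1 - sqrt 2\<close>. For such \<open>x\<close> the modulus of \<open>U u\<close> would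
  exceed 5/4.\<close>

lemma sharp_limacon:
  "sharp_bound (16 / 63 * (1 + 2 * sqrt 2)) (\<lambda>z. 1 + of_real (sqrt 2) * z + 1 / 2 * z ^ 2)"
proof (rule sharp_boundI_univalent[where s = "sqrt 2 - 1 / 2" and ?s1.0 = 1])
  show "inj_on (\<lambda>z::complex. 1 + of_real (sqrt 2) * z + 1 / 2 * z ^ 2) (ball 0 1)"
  proof (rule inj_onI)
    fix x y :: complex assume xy: "x \<in> ball 0 1" "y \<in> ball 0 1"
      and eq: "1 + of_real (sqrt 2) * x + 1 / 2 * x ^ 2 = 1 + of_real (sqrt 2) * y + 1 / 2 * y ^ 2"
    have "(x - y) * (of_real (2 * sqrt 2) + x + y) = 2 * ((1 + of_real (sqrt 2) * x + 1 / 2 * x ^ 2)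
        - (1 + of_real (sqrt 2) * y + 1 / 2 * y ^ 2))"
      by (simp add: power2_eq_square field_simps)
    then have "(x - y) * (of_real (2 * sqrt 2) + x + y) = 0" unfolding eq by simp
    then show "x = y" using two_plus_nz[of x y "2 * sqrt 2"] xy sqrt_2_bounds by auto
  qed
  fix u \<zeta> :: complex assume u: "u \<in> ball 0 1" and \<zeta>: "norm \<zeta> = 1"
  define x where "x = Re \<zeta>"
  note xy = sphere_Re_Im[OF \<zeta>, folded x_def]
  define s where "s = sqrt 2 - 1 / 2"
  have s: "s > 0" "s\<^sup>2 = 9 / 4 - sqrt 2" using sqrt_2_bounds
    by (auto simp: s_def power2_eq_square algebra_simps)
  show "1 + of_real (sqrt 2) * \<zeta> + 1 / 2 * \<zeta>\<^sup>2 \<noteq> 1 + of_real (sqrt 2 - 1 / 2) * U u"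
  proof
    assume "1 + of_real (sqrt 2) * \<zeta> + 1 / 2 * \<zeta>\<^sup>2 = 1 + of_real (sqrt 2 - 1 / 2) * U u"
    then have eq: "of_real s * U u = \<zeta> * (of_real (sqrt 2) + \<zeta> / 2)"
      by (simp add: s_def power2_eq_square algebra_simps)
    have "s\<^sup>2 * (norm (U u))\<^sup>2 = (norm (of_real s * U u))\<^sup>2" by (simp add: norm_mult power_mult_distrib)
    also have "\<dots> = 9 / 4 + sqrt 2 * x"
      unfolding eq norm_mult \<zeta> using xy(1)
      by (simp add: cmod_power2 x_def) (simp add: power2_eq_square field_simps)
    finally have N: "9 / 4 + sqrt 2 * x = s\<^sup>2 * (norm (U u))\<^sup>2" ..
    have "s * Re (U u) = Re (of_real s * U u)" by simp
    also have "\<dots> = sqrt 2 * x + x\<^sup>2 - 1 / 2"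
      unfolding eq using xy(1) by (simp add: x_def power2_eq_square field_simps)
    finally have X: "s * Re (U u) = sqrt 2 * x + x\<^sup>2 - 1 / 2" .
    have "s * (-1) < s * Re (U u)" using s U_strip(1)[OF u] by (intro mult_strict_left_mono) auto
    then have "0 < sqrt 2 * x + x\<^sup>2 - 1 / 2 + s" unfolding X by simp
    also have "\<dots> = (1 + x) * (sqrt 2 - 1 + x)"
      by (simp add: s_def power2_eq_square algebra_simps)
    finally have "0 < (1 + x) * (sqrt 2 - 1 + x)" .
    then have "x > 1 - sqrt 2" using xy by (auto simp: zero_less_mult_iff)
    then have "sqrt 2 * x > sqrt 2 * (1 - sqrt 2)" by (intro mult_strict_left_mono) auto
    then have "1 / 4 + sqrt 2 < s\<^sup>2 * (norm (U u))\<^sup>2" unfolding N[symmetric] by (simp add: algebra_simps)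
    also have "\<dots> \<le> s\<^sup>2 * (25 / 16)" using U_strip(2)[OF u] by (intro mult_left_mono) auto
    finally show False unfolding s(2) using sqrt_2_bounds by simp
  qed
next
  fix \<sigma> :: real and z :: complex assume \<sigma>: "sqrt 2 - 1 / 2 < \<sigma>" and z: "norm z < 1"
  note zb = disk_Re_Im[OF z]
  show "1 + of_real (sqrt 2) * z + 1 / 2 * z\<^sup>2 \<noteq> 1 - of_real \<sigma>"
  proof
    assume "1 + of_real (sqrt 2) * z + 1 / 2 * z\<^sup>2 = 1 - of_real \<sigma>"
    then have h: "of_real (sqrt 2) * z + 1 / 2 * z\<^sup>2 = - of_real \<sigma>" by simp
    have "(of_real (sqrt 2) + z)\<^sup>2 = of_real ((sqrt 2)\<^sup>2) + 2 * (of_real (sqrt 2) * z + 1 / 2 * z\<^sup>2)"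
      unfolding of_real_power by (simp add: power2_eq_square field_simps del: of_real_mult)
    then have eq: "(of_real (sqrt 2) + z)\<^sup>2 = of_real (2 - 2 * \<sigma>)"
      unfolding h by simp
    from arg_cong[OF eq, of Im] have "Im z = 0" using zb sqrt_2_bounds by (simp add: Im_power2)
    with arg_cong[OF eq, of Re] have "(sqrt 2 + Re z)\<^sup>2 = 2 - 2 * \<sigma>" by (simp add: Re_power2)
    moreover have "(sqrt 2 - 1)\<^sup>2 < (sqrt 2 + Re z)\<^sup>2"
      using zb sqrt_2_bounds by (intro power_strict_mono) auto
    ultimately show False using \<sigma> by (simp add: power2_eq_square algebra_simps)
  qed
qed (use sqrt_2_bounds in \<open>auto intro!: holomorphic_intros continuous_intros simp: field_simps\<close>)

section \<open>The exponential and the sine\<close>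

lemma exp_ge_taylor:
  fixes x :: real
  assumes "even n"
  shows "(\<Sum>m<n. x ^ m / fact m) \<le> exp x"
proof -
  obtain t where "exp x = (\<Sum>m<n. x ^ m / fact m) + exp t / fact n * x ^ n"
    using Maclaurin_exp_le[of x n] by blast
  then show ?thesis using assms by (simp add: zero_le_even_power)
qed

lemma exp_sum_ge: "2 + x\<^sup>2 + x ^ 4 / 12 \<le> exp x + exp (- x)" for x :: real
  using exp_ge_taylor[of 6 x] exp_ge_taylor[of 6 "- x"]
  by (simp add: lessThan_nat_numeral fact_numeral field_simps)

lemma cos_le_taylor: "cos x \<le> 1 - x\<^sup>2 / 2 + x ^ 4 / 24" for x :: real
proof -
  obtain t where "cos x = (\<Sum>m<4. cos_coeff m * x ^ m) + cos (t + 1 / 2 * real 4 * pi) / fact 4 * x ^ 4"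
    using Maclaurin_cos_expansion[of x 4] by blast
  moreover have "cos (t + 1 / 2 * real 4 * pi) / fact 4 * x ^ 4 \<le> 1 / fact 4 * x ^ 4"
    by (intro mult_right_mono divide_right_mono) auto
  ultimately show ?thesis
    by (simp add: cos_coeff_def lessThan_nat_numeral fact_numeral)
qed

text \<open>The constant \<open>1/6\<close> is the best possible: both sides agree to second order at \<open>e = 0\<close>.\<close>

lemma exp_mult_cos_le:
  fixes e y :: real
  assumes e: "0 \<le> e" "e \<le> 2" and y: "y\<^sup>2 = 2 * e - e\<^sup>2"
  shows "exp e * cos y \<le> 1 + (exp e - 1)\<^sup>2 / 6"
proof -
  \<comment> \<open>This is the gap left by the Taylor bounds below; expanding its cubic factor in
    powers of \<open>2 - e\<close> makes all coefficients positive.\<close>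
  have "0 \<le> e ^ 4 * (6 + 26 * (2 - e) + (2 - e)\<^sup>2 + (2 - e) ^ 3) / 5040"
    using e by (intro divide_nonneg_pos mult_nonneg_nonneg add_nonneg_nonneg) auto
  also have "\<dots> = e ^ 4 / 72 - e ^ 5 / 120 + e ^ 6 / 720 - e ^ 7 / 5040"
    by (simp add: eval_nat_numeral field_simps)
  finally have poly: "0 \<le> e ^ 4 / 72 - e ^ 5 / 120 + e ^ 6 / 720 - e ^ 7 / 5040" .
  have "cos y \<le> 1 - y\<^sup>2 / 2 + (y\<^sup>2)\<^sup>2 / 24" using cos_le_taylor[of y] by simp
  also have "\<dots> = 1 - e + 2 / 3 * e\<^sup>2 - e ^ 3 / 6 + e ^ 4 / 24"
    unfolding y by (simp add: eval_nat_numeral field_simps)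
  also have "\<dots> \<le> exp (- e) + (exp e + exp (- e) - 2) / 6"
  proof -
    have "1 - e + e\<^sup>2 / 2 - e ^ 3 / 6 + e ^ 4 / 24 - e ^ 5 / 120 + e ^ 6 / 720 - e ^ 7 / 5040 \<le> exp (- e)"
      using exp_ge_taylor[of 8 "- e"] by (simp add: lessThan_nat_numeral fact_numeral)
    moreover have "(e\<^sup>2 + e ^ 4 / 12) / 6 \<le> (exp e + exp (- e) - 2) / 6"
      using exp_sum_ge[of e] by simp
    ultimately show ?thesis using poly by (simp add: field_simps)
  qed
  finally have "exp e * cos y \<le> exp e * (exp (- e) + (exp e + exp (- e) - 2) / 6)"
    by (intro mult_left_mono) auto
  also have "\<dots> = 1 + (exp e - 1)\<^sup>2 / 6"
    by (simp add: exp_minus power2_eq_square field_simps)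
  finally show ?thesis .
qed

text \<open>A common boundary point would have \<open>1 + X\<close> at most quadratic in
  \<open>g\<close>, the excess of its rescaled modulus, but \<open>N - 1\<close> at least linear in
  \<open>g\<close>. The flatness of the image of \<open>U\<close> rules this out by comparing
  constants.\<close>

lemma sharp_exp: "sharp_bound (8 * exp 1 / (9 * (exp 1 - 1))) (\<lambda>z. exp z)"
proof (rule sharp_boundI_univalent[where s = "1 - exp (-1)" and ?s1.0 = 1])
  show "inj_on (\<lambda>z::complex. exp z) (ball 0 1)"
  proof (rule inj_onI)
    fix x y :: complex assume xy: "x \<in> ball 0 1" "y \<in> ball 0 1" and "exp x = exp y"
    moreover have "\<bar>Im x\<bar> < pi" "\<bar>Im y\<bar> < pi"
      using xy abs_Im_le_cmod[of x] abs_Im_le_cmod[of y] pi_gt3 by (auto simp del: abs_Im_le_cmod)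
    ultimately show "x = y" by (metis Ln_exp abs_less_iff less_imp_le minus_less_iff)
  qed
  fix u \<zeta> :: complex assume u: "u \<in> ball 0 1" and \<zeta>: "norm \<zeta> = 1"
  define e a y where "e = exp (1::real)" "a = Re \<zeta>" "y = Im \<zeta>"
  note ay = sphere_Re_Im[OF \<zeta>, folded e_a_y_def]
  have e: "1 < e" "e \<le> 3" using exp_le by (auto simp: e_a_y_def)
  define X N where "X = Re (U u)" "N = (norm (U u))\<^sup>2"
  \<comment> \<open>\<open>1 + g\<close> and \<open>1 + D\<close> are the modulus and the real part
    of \<open>e * exp \<zeta>\<close>; both \<open>g\<close> and \<open>D\<close> vanish at the
    touching point \<open>\<zeta> = -1\<close>.\<close>
  define g D where "g = exp (1 + a) - 1" "D = (1 + g) * cos y - 1"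
  show "exp \<zeta> \<noteq> 1 + of_real (1 - exp (-1)) * U u"
  proof
    assume eq: "exp \<zeta> = 1 + of_real (1 - exp (-1)) * U u"
    have g: "g \<ge> 0" using ay by (simp add: g_D_def)
    have ge: "1 + g = e * exp a" by (simp add: g_D_def exp_add e_a_y_def(1))
    have ei: "exp (-1) = 1 / e" by (simp add: e_a_y_def exp_minus field_simps)
    have mul: "of_real e * exp \<zeta> = of_real e + of_real (e - 1) * U u"
      unfolding eq ei using e by (simp add: field_simps)
    from arg_cong[OF mul, of Re] have D: "D = (e - 1) * (1 + X)"
      by (simp add: Re_exp X_N_def g_D_def(2) ge algebra_simps e_a_y_def(2,3))
    have "(norm (of_real e * exp \<zeta>))\<^sup>2 = (1 + g)\<^sup>2"
      using e by (simp add: norm_mult ge e_a_y_def(2))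
    then have "(1 + g)\<^sup>2 = e\<^sup>2 + 2 * e * (e - 1) * X + (e - 1)\<^sup>2 * N"
      unfolding mul cmod_power2 X_N_def by (simp add: power2_eq_square algebra_simps)
    then have M: "(e - 1)\<^sup>2 * (N - 1) = g\<^sup>2 + 2 * g - 2 * e * D"
      unfolding D by (simp add: power2_eq_square algebra_simps)
    have "X > -1" using U_strip(1)[OF u] by (simp add: X_N_def)
    then have "D > 0" unfolding D using e by simp
    have "D \<le> g\<^sup>2 / 6"
      using exp_mult_cos_le[of "1 + a" y] ay by (simp add: g_D_def power2_eq_square field_simps)
    then have "g \<noteq> 0" using \<open>D > 0\<close> by auto
    then have "g > 0" using g by simp
    have "e * D \<le> 3 * D" using e \<open>D > 0\<close> by (intro mult_right_mono) auto
    \<comment> \<open>\<open>e \<le> 3\<close> and \<open>D \<le> g\<^sup>2 / 6\<close> give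
      \<open>2 * e * D \<le> g\<^sup>2\<close>, which the term \<open>g\<^sup>2\<close> in
      \<open>M\<close> absorbs.\<close>
    then have M2: "2 * g \<le> (e - 1)\<^sup>2 * (N - 1)" 
      unfolding M mult.assoc using \<open>D \<le> g\<^sup>2 / 6\<close> by linarith
    then have "0 < (e - 1)\<^sup>2 * (N - 1)" using \<open>g > 0\<close> by linarith
    then have "N \<ge> 1" using e by (simp add: zero_less_mult_iff)
    then have flat: "32 / 27 * (N - 1)\<^sup>2 \<le> 1 + X"
      using U_flat[OF u] unfolding X_N_def by simp
    have "32 / 27 * (4 * g\<^sup>2) = 32 / 27 * (2 * g)\<^sup>2" by simp
    also have "\<dots> \<le> 32 / 27 * ((e - 1)\<^sup>2 * (N - 1))\<^sup>2"
      using M2 \<open>g > 0\<close> by (intro mult_left_mono power_mono) auto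
    also have "\<dots> = (e - 1) ^ 4 * (32 / 27 * (N - 1)\<^sup>2)"
      by (simp add: power_mult_distrib flip: power_mult)
    also have "\<dots> \<le> (e - 1) ^ 4 * (1 + X)" using flat by (intro mult_left_mono) auto
    also have "\<dots> = (e - 1) ^ 3 * D" unfolding D by (simp add: eval_nat_numeral)
    also have "\<dots> \<le> 2 ^ 3 * (g\<^sup>2 / 6)"
      using e \<open>D > 0\<close> \<open>D \<le> g\<^sup>2 / 6\<close> by (intro mult_mono power_mono) auto
    finally show False using \<open>g > 0\<close> by simp
  qed
next
  fix \<sigma> :: real and z :: complex assume \<sigma>: "1 - exp (-1) < \<sigma>" "\<sigma> < 1" and z: "norm z < 1"
  show "exp z \<noteq> 1 - of_real \<sigma>"
  proof
    assume "exp z = 1 - of_real \<sigma>"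
    then have "norm (exp z) = norm (of_real (1 - \<sigma>) :: complex)" by simp
    then have "exp (Re z) = 1 - \<sigma>" using \<sigma> by (simp del: of_real_diff)
    moreover have "exp (Re z) > exp (-1)" using disk_Re_Im[OF z] by simp
    ultimately show False using \<sigma> by simp
  qed
qed (auto intro!: holomorphic_intros continuous_intros simp: exp_minus field_simps)

section \<open>Estimates for the sine and its superordinate\<close>

lemma sin_taylor_bounds:
  fixes x :: real
  assumes "x \<ge> 0"
  shows "x - x ^ 3 / 6 + x ^ 5 / 120 - x ^ 7 / 5040 \<le> sin x"
    "sin x \<le> x - x ^ 3 / 6 + x ^ 5 / 120 + x ^ 7 / 5040"
proof -
  have "(\<Sum>m<7. sin_coeff m * x ^ m) = x - x ^ 3 / 6 + x ^ 5 / 120"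
    by (simp add: sin_coeff_def lessThan_nat_numeral fact_numeral)
  with Maclaurin_sin_bound[of x 7] have "\<bar>sin x - (x - x ^ 3 / 6 + x ^ 5 / 120)\<bar> \<le> x ^ 7 / 5040"
    using assms by (simp add: fact_numeral field_simps)
  then show "x - x ^ 3 / 6 + x ^ 5 / 120 - x ^ 7 / 5040 \<le> sin x"
    "sin x \<le> x - x ^ 3 / 6 + x ^ 5 / 120 + x ^ 7 / 5040" by linarith+
qed

lemma sin_1_bounds: "84 / 100 < sin (1::real)" "sin (1::real) < 842 / 1000"
  using sin_taylor_bounds[of 1] by auto

text \<open>\<open>sin x * (3 - x\<^sup>2) / 2\<close> is concave on the unit interval and equals
  \<open>sin 1\<close> at 1, so a lower bound at \<open>l\<close> and at 1 persists between
  them.\<close>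

lemma sin_mult_concave:
  fixes a l :: real
  assumes "0 \<le> l" "l \<le> a" "a \<le> 1" "c \<le> sin l * (3 - l\<^sup>2) / 2" "c \<le> sin 1"
  shows "c \<le> sin a * (3 - a\<^sup>2) / 2"
proof -
  define f where "f x = - (sin x * (3 - x\<^sup>2) / 2)" for x :: real
  have cvx: "convex_on {0..1} f"
  proof (rule f''_ge0_imp_convex)
    fix x :: real assume x: "x \<in> {0..1}"
    show "(f has_real_derivative x * sin x - cos x * (3 - x\<^sup>2) / 2) (at x)"
      unfolding f_def by (auto intro!: derivative_eq_intros simp: field_simps)
    show "((\<lambda>x. x * sin x - cos x * (3 - x\<^sup>2) / 2) has_real_derivative
        sin x + 2 * x * cos x + sin x * (3 - x\<^sup>2) / 2) (at x)"
      by (auto intro!: derivative_eq_intros simp: field_simps)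
    have "x\<^sup>2 \<le> 1" using x by (simp add: power_le_one)
    moreover have "sin x \<ge> 0" "cos x \<ge> 0"
      using x pi_gt3 by (auto intro!: sin_ge_zero cos_ge_zero)
    ultimately show "0 \<le> sin x + 2 * x * cos x + sin x * (3 - x\<^sup>2) / 2"
      using x by (intro add_nonneg_nonneg) auto
  qed simp
  obtain t where t: "0 \<le> t" "t \<le> 1" "a = (1 - t) * l + t * 1"
  proof (cases "l = 1")
    case True
    then show ?thesis using assms that[of 0] by simp
  next
    case False
    then have l: "l < 1" using assms by simp
    define t where "t = (a - l) / (1 - l)"
    have "a = l + t * (1 - l)" using l by (simp add: t_def)
    moreover have "0 \<le> t" "t \<le> 1" using l assms by (auto simp: t_def)
    ultimately show ?thesis by (intro that[of t]) (auto simp: algebra_simps)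
  qed
  have "f a \<le> (1 - t) * f l + t * f 1"
    unfolding t(3) using assms(1-3) t convex_onD[OF cvx, of t l 1] by simp
  also have "\<dots> \<le> (1 - t) * (- c) + t * (- c)"
    using t assms by (intro add_mono mult_left_mono) (auto simp: f_def)
  finally show ?thesis by (simp add: f_def algebra_simps)
qed

text \<open>In \<open>|sin (x + iy)|^2 = (cosh 2y - cos 2x) / 2\<close> the quartic Taylor terms
  form a multiple of \<open>y^4 - x^4\<close>, which is linear in \<open>x^2\<close> on the unit
  circle.\<close>

lemma norm_sin_ge:
  assumes "norm \<zeta> = 1"
  shows "(4 - 2 * (Re \<zeta>)\<^sup>2) / 3 \<le> (norm (sin \<zeta>))\<^sup>2"
proof -
  define a y where "a = (Re \<zeta>)\<^sup>2" "y = (Im \<zeta>)\<^sup>2"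
  have ay: "y = 1 - a" using sphere_Re_Im(1)[OF assms] by (simp add: a_y_def)
  have "2 + 4 * y + 4 / 3 * y\<^sup>2 \<le> exp (2 * Im \<zeta>) + exp (- (2 * Im \<zeta>))"
    using exp_sum_ge[of "2 * Im \<zeta>"] by (simp add: a_y_def power_mult_distrib flip: power_mult)
  moreover have "cos (2 * Re \<zeta>) \<le> 1 - 2 * a + 2 / 3 * a\<^sup>2"
    using cos_le_taylor[of "2 * Re \<zeta>"] by (simp add: a_y_def power_mult_distrib flip: power_mult)
  ultimately have "(2 + 4 * y + 4 / 3 * y\<^sup>2 - 2 * (1 - 2 * a + 2 / 3 * a\<^sup>2)) / 4 \<le> (norm (sin \<zeta>))\<^sup>2"
    unfolding norm_sin_squared exp_minus by (intro divide_right_mono diff_mono) auto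
  moreover have "(2 + 4 * y + 4 / 3 * y\<^sup>2 - 2 * (1 - 2 * a + 2 / 3 * a\<^sup>2)) / 4 = (4 - 2 * a) / 3"
    unfolding ay by (simp add: power2_eq_square field_simps)
  ultimately show ?thesis by (simp add: a_y_def)
qed

text \<open>The real part is \<open>sin x cosh y\<close>, and
  \<open>cosh y \<ge> 1 + y^2 / 2 = (3 - x^2) / 2\<close> on the unit circle.\<close>

lemma Re_sin_ge:
  assumes "norm \<zeta> = 1"
  shows "sin \<bar>Re \<zeta>\<bar> * (3 - (Re \<zeta>)\<^sup>2) / 2 \<le> \<bar>Re (sin \<zeta>)\<bar>"
proof -
  note xy = sphere_Re_Im[OF assms]
  have "3 - (Re \<zeta>)\<^sup>2 \<le> exp (Im \<zeta>) + exp (- Im \<zeta>)"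
  proof -
    have "0 \<le> Im \<zeta> ^ 4 / 12" by simp
    then show ?thesis using exp_sum_ge[of "Im \<zeta>"] xy(1) by linarith
  qed
  moreover have s: "\<bar>sin (Re \<zeta>)\<bar> = sin \<bar>Re \<zeta>\<bar>" "sin \<bar>Re \<zeta>\<bar> \<ge> 0"
  proof -
    show "sin \<bar>Re \<zeta>\<bar> \<ge> 0" using xy pi_gt3 by (intro sin_ge_zero) auto
    then show "\<bar>sin (Re \<zeta>)\<bar> = sin \<bar>Re \<zeta>\<bar>" by (auto simp: abs_if split: if_splits)
  qed
  ultimately have "sin \<bar>Re \<zeta>\<bar> * (3 - (Re \<zeta>)\<^sup>2) \<le> sin \<bar>Re \<zeta>\<bar> * (exp (Im \<zeta>) + exp (- Im \<zeta>))"
    by (intro mult_left_mono) auto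
  moreover have "\<bar>Re (sin \<zeta>)\<bar> = sin \<bar>Re \<zeta>\<bar> * (exp (Im \<zeta>) + exp (- Im \<zeta>)) / 2"
    by (simp add: Re_sin abs_mult s(1))
  ultimately show ?thesis by simp
qed

lemma sharp_sin: "sharp_bound (8 / (9 * sin 1)) (\<lambda>z. 1 + sin z)"
proof (rule sharp_boundI_univalent[where s = "sin 1" and ?s1.0 = 1])
  show "inj_on (\<lambda>z::complex. 1 + sin z) (ball 0 1)"
  proof (rule inj_onI)
    fix x y :: complex assume xy: "x \<in> ball 0 1" "y \<in> ball 0 1" and eq: "1 + sin x = 1 + sin y"
    have "Arcsin (sin z) = z" if "z \<in> ball 0 1" for z
      using disk_Re_Im[of z] that pi_gt3 by (intro Arcsin_sin) auto
    then show "x = y" using xy eq by (metis add_left_cancel)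
  qed
  fix u \<zeta> :: complex assume u: "u \<in> ball 0 1" and \<zeta>: "norm \<zeta> = 1"
  define s where "s = sin (1::real)"
  have s: "84 / 100 < s" "s < 842 / 1000" using sin_1_bounds by (auto simp: s_def)
  have "s\<^sup>2 < (842 / 1000)\<^sup>2" using s by (intro power_strict_mono) auto
  then have s2: "s\<^sup>2 < 709 / 1000" "s\<^sup>2 > 0" using s by (auto simp: power2_eq_square)
  define a where "a = \<bar>Re \<zeta>\<bar>"
  have a: "0 \<le> a" "a \<le> 1" using sphere_Re_Im[OF \<zeta>] by (auto simp: a_def)
  define X N where "X = \<bar>Re (U u)\<bar>" "N = (norm (U u))\<^sup>2"
  have XN: "X < 1" "N \<le> 25 / 16" "0 \<le> X" using U_strip[OF u] by (auto simp: X_N_def)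
  show "1 + sin \<zeta> \<noteq> 1 + of_real (sin 1) * U u"
  proof
    assume "1 + sin \<zeta> = 1 + of_real (sin 1) * U u"
    then have eq: "sin \<zeta> = of_real s * U u" by (simp only: s_def add_left_cancel)
    have N: "(4 - 2 * a\<^sup>2) / 3 \<le> s\<^sup>2 * N"
      using norm_sin_ge[OF \<zeta>] unfolding eq by (simp add: a_def X_N_def norm_mult power_mult_distrib)
    have X: "sin a * (3 - a\<^sup>2) / 2 \<le> s * X"
      using Re_sin_ge[OF \<zeta>] s unfolding eq by (simp add: a_def X_N_def abs_mult)
    \<comment> \<open>On each subinterval the lower bound for \<open>N\<close> decreases in
      \<open>a\<close> and is taken at the right end \<open>h\<close>; \<open>Xge\<close> uses the
      left end \<open>l\<close>, by concavity.\<close>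
    have Nge: "d / (709 / 1000) \<le> N" if "a \<le> h" "0 \<le> d" "d \<le> (4 - 2 * h\<^sup>2) / 3" for d h
    proof -
      have "a\<^sup>2 \<le> h\<^sup>2" using that a by (intro power_mono) auto
      then have "d \<le> s\<^sup>2 * N" using N that by simp
      also have "\<dots> \<le> 709 / 1000 * N" using s2 by (intro mult_right_mono) (auto simp: X_N_def)
      finally show ?thesis by simp
    qed
    have Xge: "c / (842 / 1000) \<le> X"
      if "0 \<le> l" "l \<le> a" "c \<le> (l - l ^ 3 / 6 + l ^ 5 / 120 - l ^ 7 / 5040) * (3 - l\<^sup>2) / 2" "c \<le> 84 / 100"
      for c l
    proof -
      have "l\<^sup>2 \<le> 1" using that a by (intro power_le_one) auto
      then have "(l - l ^ 3 / 6 + l ^ 5 / 120 - l ^ 7 / 5040) * (3 - l\<^sup>2) / 2 \<le> sin l * (3 - l\<^sup>2) / 2"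
        using sin_taylor_bounds(1)[OF that(1)] by (intro divide_right_mono mult_right_mono) auto
      then have "c \<le> sin l * (3 - l\<^sup>2) / 2" using that(3) by (rule order_trans[rotated])
      moreover have "c \<le> sin 1" using that(4) s(1) unfolding s_def by linarith
      ultimately have "c \<le> sin a * (3 - a\<^sup>2) / 2"
        by (rule sin_mult_concave[OF that(1,2) a(2)])
      also have "\<dots> \<le> s * X" by (rule X)
      also have "\<dots> \<le> 842 / 1000 * X" using s XN by (intro mult_right_mono) auto
      finally show ?thesis by simp
    qed
    have flat: False if "1 - X < 32 / 27 * d\<^sup>2" "0 \<le> d" "d \<le> N - 1" for d
    proof -
      have "d\<^sup>2 \<le> (N - 1)\<^sup>2" using that by (intro power_mono) auto
      moreover have "32 / 27 * (N - 1)\<^sup>2 \<le> 1 - X"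
        using U_flat[OF u] that by (simp add: X_N_def)
      ultimately show False using that by linarith
    qed
    \<comment> \<open>For small \<open>a\<close> the modulus of \<open>U u\<close> exceeds 5/4; for
      \<open>a \<ge> 8 / 10\<close> its real part leaves the strip. On the two middle intervals the
      bounds for \<open>X\<close> and \<open>N\<close> together contradict
      \<open>U_flat\<close>.\<close>
    consider "a \<le> 57 / 100" | "57 / 100 \<le> a" "a \<le> 7 / 10" | "7 / 10 \<le> a" "a \<le> 8 / 10" | "8 / 10 \<le> a"
      by linarith
    then show False
    proof cases
      case 1
      from Nge[OF this, of "11167 / 10000"] XN show False by (simp add: power2_eq_square)
    next
      case 2
      have "72 / 100 / (842 / 1000) \<le> X" using 2 by (intro Xge[of "57 / 100"]) (auto simp: eval_nat_numeral)
      moreover have "1006 / 1000 / (709 / 1000) \<le> N" using 2 by (intro Nge[of "7 / 10"]) (auto simp: eval_nat_numeral)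
      ultimately show False by (intro flat[of "418 / 1000"]) (auto simp: power2_eq_square)
    next
      case 3
      have "807 / 1000 / (842 / 1000) \<le> X" using 3 by (intro Xge[of "7 / 10"]) (auto simp: eval_nat_numeral)
      moreover have "906 / 1000 / (709 / 1000) \<le> N" using 3 by (intro Nge[of "8 / 10"]) (auto simp: eval_nat_numeral)
      ultimately show False by (intro flat[of "277 / 1000"]) (auto simp: power2_eq_square)
    next
      case 4
      have "s \<le> 842 / 1000" using s by simp
      also have "842 / 1000 \<le> sin (8 / 10) * (3 - (8 / 10)\<^sup>2) / (2::real)"
        using sin_taylor_bounds(1)[of "8 / 10"] by (simp add: eval_nat_numeral)
      finally have s8: "s \<le> sin (8 / 10) * (3 - (8 / 10)\<^sup>2) / 2" .
      have "s \<le> sin a * (3 - a\<^sup>2) / 2"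
        by (rule sin_mult_concave[OF _ 4 a(2) s8]) (simp_all add: s_def)
      then have "s * 1 \<le> s * X" using X by simp
      then show False using XN s by simp
    qed
  qed
next
  fix \<sigma> :: real and z :: complex assume \<sigma>: "sin 1 < \<sigma>" and z: "norm z < 1"
  note zb = disk_Re_Im[OF z]
  show "1 + sin z \<noteq> 1 - of_real \<sigma>"
  proof
    assume "1 + sin z = 1 - of_real \<sigma>"
    then have eq: "sin z = of_real (- \<sigma>)" by simp
    have "cos (Re z) > 0" using zb pi_gt3 by (intro cos_gt_zero_pi) auto
    with arg_cong[OF eq, of Im] have "Im z = 0" by (simp add: Im_sin)
    with arg_cong[OF eq, of Re] have "sin (Re z) = - \<sigma>" by (simp add: Re_sin)
    moreover have "sin (- 1) < sin (Re z)"
      using zb pi_gt3 by (subst sin_mono_less_eq) auto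
    ultimately show False using \<sigma> by simp
  qed
qed (use sin_1_bounds in \<open>auto intro!: holomorphic_intros continuous_intros\<close>)

section \<open>The rational function and the nephroid\<close>

text \<open>\<open>K\<^sup>2 = 2 * K + 1\<close> gives \<open>1 - P (-1) = 1 / K\<^sup>2\<close> and
  makes the norm estimate for injectivity just strict. At a common boundary point the strip forces
  \<open>x > 0\<close>, and then \<open>norm (U u)\<^sup>2\<close> exceeds
  \<open>K\<^sup>2 > 4\<close>.\<close>

lemma sharp_rational:
  "sharp_bound (8 / 9 * (3 + 2 * sqrt 2))
    (\<lambda>z. 1 + z / of_real (1 + sqrt 2) * ((of_real (1 + sqrt 2) + z) / (of_real (1 + sqrt 2) - z)))"
proof -
  define K where "K = 1 + sqrt 2"
  have K: "K > 2" "K\<^sup>2 = 2 * K + 1" using sqrt_2_bounds by (auto simp: K_def power2_eq_square algebra_simps)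
  have K': "K * K = 2 * K + 1" using K(2) by (simp add: power2_eq_square)
  have s: "3 - 2 * sqrt 2 = 1 / K\<^sup>2"
    unfolding K(2) unfolding K_def using sqrt_2_bounds by (simp add: field_simps)
  have nz: "of_real K - z \<noteq> 0" if "norm z \<le> 1" for z :: complex
    using that K by auto
  have K0: "complex_of_real K \<noteq> 0" using K by simp
  define P where "P z = 1 + z / of_real K * ((of_real K + z) / (of_real K - z))" for z :: complex
  have "sharp_bound (8 / 9 * (3 + 2 * sqrt 2)) P"
  proof (rule sharp_boundI_univalent[where s = "1 / K\<^sup>2" and ?s1.0 = 1])
    show "8 / 9 * (3 + 2 * sqrt 2) = 8 / (9 * (1 / K\<^sup>2))"
      unfolding K(2) by (simp add: K_def)
    show "P holomorphic_on ball 0 1" unfolding P_def using nz K0 by (intro holomorphic_intros) auto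
    show "continuous_on (cball 0 1) P" unfolding P_def using nz K0 by (intro continuous_intros) auto
    show "1 / K\<^sup>2 > 0" "1 / K\<^sup>2 < 1" using K by auto
    show "P 0 = 1" by (simp add: P_def)
    show "inj_on P (ball 0 1)"
    proof (rule inj_onI)
      fix x y assume xy: "x \<in> ball 0 1" "y \<in> ball 0 1" and eq: "P x = P y"
      have nx: "of_real K - x \<noteq> 0" and ny: "of_real K - y \<noteq> 0" using nz xy by auto
      from eq have "x * (of_real K + x) * (of_real K - y) = y * (of_real K + y) * (of_real K - x)"
        using nx ny K0 unfolding P_def by (simp add: frac_eq_eq mult.assoc)
      then have "(x - y) * (of_real K * of_real K + of_real K * (x + y) - x * y) = 0"
        by (simp add: algebra_simps)
      moreover have "of_real K * of_real K + of_real K * (x + y) - x * y \<noteq> 0"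
      proof
        assume "of_real K * of_real K + of_real K * (x + y) - x * y = 0"
        then have "of_real (K * K) = x * y - of_real K * x - of_real K * y" by (simp add: algebra_simps)
        then have "norm (complex_of_real (K * K)) \<le> norm (x * y) + norm (of_real K * x) + norm (of_real K * y)"
          by (metis norm_triangle_ineq4 order_trans add_right_mono)
        moreover have "norm x * norm y < 1 * 1" using xy by (intro mult_strict_mono) auto
        moreover have "K * norm x \<le> K * 1" "K * norm y \<le> K * 1"
          using xy K by (auto intro!: mult_left_mono)
        ultimately show False using K K' by (simp add: norm_mult del: of_real_mult)
      qed
      ultimately show "x = y" by simp
    qed
  next
    fix u \<zeta> :: complex assume u: "u \<in> ball 0 1" and \<zeta>: "norm \<zeta> = 1"
    define x y X Y where "x = Re \<zeta>" "y = Im \<zeta>" "X = Re (U u)" "Y = Im (U u)"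
    note xy = sphere_Re_Im[OF \<zeta>, folded x_y_X_Y_def]
    have nzc: "of_real K - \<zeta> \<noteq> 0" using nz \<zeta> by simp
    have pos: "K + 1 - K * x > 0"
    proof -
      have "K * x \<le> K * 1" using xy K by (intro mult_left_mono) auto
      then show ?thesis by simp
    qed
    show "P \<zeta> \<noteq> 1 + of_real (1 / K\<^sup>2) * U u"
    proof
      assume "P \<zeta> = 1 + of_real (1 / K\<^sup>2) * U u"
      then have "of_real K * (U u * (of_real K - \<zeta>)) = of_real K * (of_real K * (\<zeta> * (of_real K + \<zeta>)))"
        using nzc K0 by (simp add: P_def power2_eq_square field_simps)
      then have eq: "U u * (of_real K - \<zeta>) = of_real K * (\<zeta> * (of_real K + \<zeta>))"
        by (rule mult_left_cancel[OF K0, THEN iffD1])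
      have "(norm (U u * (of_real K - \<zeta>)))\<^sup>2 = (norm (U u))\<^sup>2 * (2 * (K + 1 - K * x))"
      proof -
        have "(norm (of_real K - \<zeta>))\<^sup>2 = K\<^sup>2 - 2 * K * x + (x\<^sup>2 + y\<^sup>2)"
          unfolding cmod_power2 by (simp add: x_y_X_Y_def power2_eq_square algebra_simps)
        then show ?thesis by (simp add: norm_mult power_mult_distrib xy(1) K(2))
      qed
      moreover have "(norm (of_real K * (\<zeta> * (of_real K + \<zeta>))))\<^sup>2 = K\<^sup>2 * (2 * (K + 1 + K * x))"
      proof -
        have "(norm (of_real K + \<zeta>))\<^sup>2 = K\<^sup>2 + 2 * K * x + (x\<^sup>2 + y\<^sup>2)"
          unfolding cmod_power2 by (simp add: x_y_X_Y_def power2_eq_square algebra_simps)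
        then show ?thesis by (simp add: norm_mult power_mult_distrib xy(1) K(2) \<zeta>)
      qed
      ultimately have "2 * ((norm (U u))\<^sup>2 * (K + 1 - K * x)) = 2 * (K\<^sup>2 * (K + 1 + K * x))"
        unfolding eq by (simp only: mult_ac)
      then have N: "(norm (U u))\<^sup>2 * (K + 1 - K * x) = K\<^sup>2 * (K + 1 + K * x)" by simp
      have re: "X * (K - x) + Y * y = K * (x * (K + x) - y\<^sup>2)"
        and im: "Y * (K - x) - X * y = K * (y * (K + x) + x * y)"
        using arg_cong[OF eq, of Re] arg_cong[OF eq, of Im]
        by (auto simp: x_y_X_Y_def power2_eq_square algebra_simps)
      \<comment> \<open>Multiplication of \<open>eq\<close> by the conjugate of
        \<open>K - \<zeta>\<close> isolates the real part of \<open>U u\<close>.\<close>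
      have "X * ((K - x)\<^sup>2 + y\<^sup>2) = (X * (K - x) + Y * y) * (K - x) - (Y * (K - x) - X * y) * y"
        by (simp add: power2_eq_square algebra_simps)
      also have "\<dots> = K * ((K\<^sup>2 - 1) * x * (x\<^sup>2 + y\<^sup>2) + K * (x\<^sup>2 - y\<^sup>2) - K * (x\<^sup>2 + y\<^sup>2))
          + K * (K\<^sup>2 * x * (1 - (x\<^sup>2 + y\<^sup>2)))"
        unfolding re im by (simp add: power2_eq_square algebra_simps)
      finally have "X * ((K - x)\<^sup>2 + y\<^sup>2) = K * (2 * K * x + K * (2 * x\<^sup>2 - 1) - K)"
        by (simp add: xy(1) K(2))
      moreover have "(K - x)\<^sup>2 + y\<^sup>2 = 2 * (K + 1 - K * x)"
        unfolding xy(1) power2_diff K(2) by simp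
      ultimately have "X * (2 * (K + 1 - K * x)) = K * (2 * K * x + K * (2 * x\<^sup>2 - 1) - K)"
        by (simp only:)
      then have "2 * (X * (K + 1 - K * x)) = 2 * (K\<^sup>2 * (x\<^sup>2 + x - 1))"
        by (simp add: power2_eq_square algebra_simps)
      then have X: "X * (K + 1 - K * x) = K\<^sup>2 * (x\<^sup>2 + x - 1)" by simp
      have "X > -1" using U_strip(1)[OF u] by (simp add: x_y_X_Y_def)
      then have "- 1 * (K + 1 - K * x) < X * (K + 1 - K * x)"
        using pos by (intro mult_strict_right_mono)
      then have "0 < (1 + x) * (K\<^sup>2 * x - K)"
        unfolding X K(2) by (simp add: power2_eq_square algebra_simps)
      then have "K\<^sup>2 * x > K" using xy by (auto simp: zero_less_mult_iff)
      then have x0: "x > 0" using K by (smt (verit) zero_less_mult_pos zero_le_power2 mult_nonneg_nonpos)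
      have "25 / 16 * (K + 1 - K * x) < K\<^sup>2 * (K + 1 + K * x)"
        using K x0 pos by (intro mult_strict_mono) (auto simp: K(2))
      moreover have "(norm (U u))\<^sup>2 * (K + 1 - K * x) \<le> 25 / 16 * (K + 1 - K * x)"
        using U_strip(2)[OF u] pos by (intro mult_right_mono) auto
      ultimately show False using N by simp
    qed
  next
    fix \<sigma> :: real and z :: complex assume \<sigma>: "1 / K\<^sup>2 < \<sigma>" "\<sigma> < 1" and z: "norm z < 1"
    note zb = disk_Re_Im[OF z]
    show "P z \<noteq> 1 - of_real \<sigma>"
    proof
      assume "P z = 1 - of_real \<sigma>"
      \<comment> \<open>A real root is excluded by the negative discriminant
        \<open>K\<^sup>2 * ((3 - \<sigma>)\<^sup>2 - 8)\<close>; nonreal roots are conjugate with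
        product \<open>\<sigma> * K\<^sup>2 > 1\<close>, so they lie outside the disk.\<close>
      then have eq: "z\<^sup>2 + of_real (K * (1 - \<sigma>)) * z + of_real (\<sigma> * K\<^sup>2) = 0"
        using nz[of z] z K0 by (simp add: P_def power2_eq_square field_simps)
      define x y where "x = Re z" "y = Im z"
      have re: "x\<^sup>2 - y\<^sup>2 + K * (1 - \<sigma>) * x + \<sigma> * K\<^sup>2 = 0"
        using arg_cong[OF eq, of Re] by (simp add: x_y_def Re_power2)
      have im: "y * (2 * x + K * (1 - \<sigma>)) = 0"
        using arg_cong[OF eq, of Im] by (simp add: x_y_def Im_power2 algebra_simps)
      show False
      proof (cases "y = 0")
        case True
        have "(2 * x + K * (1 - \<sigma>))\<^sup>2 = K\<^sup>2 * ((3 - \<sigma>)\<^sup>2 - 8)"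
          using re True by (simp add: power2_eq_square algebra_simps)
        moreover have "(3 - \<sigma>)\<^sup>2 < (2 * sqrt 2)\<^sup>2"
          using \<sigma> unfolding s[symmetric] by (intro power_strict_mono) auto
        then have "K\<^sup>2 * ((3 - \<sigma>)\<^sup>2 - 8) < 0"
          using K by (intro mult_pos_neg) (auto simp: power_mult_distrib)
        ultimately show False by (smt (verit) zero_le_power2)
      next
        case False
        then have "K * (1 - \<sigma>) = - 2 * x" using im by auto
        then have "x\<^sup>2 + y\<^sup>2 = \<sigma> * K\<^sup>2" using re by (simp add: power2_eq_square)
        moreover have "\<sigma> * K\<^sup>2 > 1" using \<sigma> K by (simp add: field_simps)
        ultimately show False using zb(1) by (simp add: x_y_def)
      qed
    qed
  qed
  then show ?thesis unfolding P_def[abs_def] K_def .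
qed

text \<open>At a common point the modulus bound 5/4 pushes \<open>\<zeta>\<close> close to the cusps
  at 1 and -1, and there \<open>norm (Re (U u)) \<ge> 1\<close>, against the strip.\<close>

lemma sharp_nephroid: "sharp_bound (4 / 3) phi_Ne"
proof (rule sharp_boundI_univalent[where s = "2 / 3" and ?s1.0 = 1])
  show "inj_on phi_Ne (ball 0 1)"
  proof (rule inj_onI, rule ccontr)
    fix a b assume ab: "a \<in> ball 0 1" "b \<in> ball 0 1" and eq: "phi_Ne a = phi_Ne b" and "a \<noteq> b"
    have "(a - b) * (3 - (a\<^sup>2 + a * b + b\<^sup>2)) = 3 * (phi_Ne a - phi_Ne b)"
      by (simp add: phi_Ne_def power3_eq_cube power2_eq_square algebra_simps)
    with eq \<open>a \<noteq> b\<close> have 3: "3 = a\<^sup>2 + a * b + b\<^sup>2" by simp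
    have n: "norm a * norm b < 1 * 1" if "norm a < 1" "norm b < 1" for a b :: complex
      using that by (intro mult_strict_mono') auto
    have "3 = norm (a\<^sup>2 + a * b + b\<^sup>2)" unfolding 3[symmetric] by simp
    also have "\<dots> \<le> norm (a\<^sup>2) + norm (a * b) + norm (b\<^sup>2)"
      by (intro order_trans[OF norm_triangle_ineq] add_right_mono norm_triangle_ineq)
    also have "\<dots> < 1 + 1 + 1"
      using ab n[of a a] n[of a b] n[of b b] by (simp add: norm_mult norm_power power2_eq_square)
    finally show False by simp
  qed
  fix u \<zeta> :: complex assume u: "u \<in> ball 0 1" and \<zeta>: "norm \<zeta> = 1"
  define t where "t = \<bar>Re \<zeta>\<bar>"
  have t: "0 \<le> t" "t \<le> 1" "t\<^sup>2 = (Re \<zeta>)\<^sup>2" using sphere_Re_Im[OF \<zeta>] by (auto simp: t_def)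
  have y: "(Im \<zeta>)\<^sup>2 = 1 - t\<^sup>2" using sphere_Re_Im(1)[OF \<zeta>] t by simp
  show "phi_Ne \<zeta> \<noteq> 1 + of_real (2 / 3) * U u"
  proof
    assume h: "phi_Ne \<zeta> = 1 + of_real (2 / 3) * U u"
    have "(3 * \<zeta> - \<zeta> ^ 3) / 2 = 3 / 2 * (phi_Ne \<zeta> - 1)" by (simp add: phi_Ne_def field_simps)
    then have eq: "U u = (3 * \<zeta> - \<zeta> ^ 3) / 2" unfolding h by simp
    have "(norm (U u))\<^sup>2 = 1 + 3 * (Im \<zeta>)\<^sup>2"
      using nephroid_boundary(1)[OF \<zeta>] unfolding eq by (simp add: norm_divide power_divide)
    then have "t\<^sup>2 \<ge> (9 / 10)\<^sup>2" using U_strip(2)[OF u] y by (simp add: power2_eq_square)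
    then have t9: "t \<ge> 9 / 10" using t(1) by (rule power2_le_imp_le)
    have "Re (U u) = Re \<zeta> * (3 - (Re \<zeta>)\<^sup>2 + 3 * (Im \<zeta>)\<^sup>2) / 2"
      unfolding eq by (simp add: power3_eq_cube power2_eq_square algebra_simps)
    then have "Re (U u) = Re \<zeta> * (3 - 2 * t\<^sup>2)" by (simp add: y right_diff_distrib flip: t(3))
    moreover have "t\<^sup>2 \<le> 1" using t(1,2) by (rule power_le_one)
    ultimately have "\<bar>Re (U u)\<bar> = t * (3 - 2 * t\<^sup>2)" by (simp add: abs_mult t_def)
    also have "\<dots> = 1 + (1 - t) * (2 * t\<^sup>2 + 2 * t - 1)"
      by (simp add: power2_eq_square algebra_simps)
    also have "\<dots> \<ge> 1"
    proof -
      have "2 * t\<^sup>2 + 2 * t - 1 \<ge> 0" using t9 zero_le_power2[of t] by linarith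
      then show ?thesis using t(2) by simp
    qed
    finally show False using U_strip(1)[OF u] by simp
  qed
next
  fix \<sigma> :: real and z :: complex assume \<sigma>: "2 / 3 < \<sigma>" and z: "norm z < 1"
  define x y where "x = Re z" "y = Im z"
  note zb = disk_Re_Im[OF z, folded x_y_def]
  show "phi_Ne z \<noteq> 1 - of_real \<sigma>"
  proof
    assume "phi_Ne z = 1 - of_real \<sigma>"
    then have eq: "3 * z - z ^ 3 = of_real (- 3 * \<sigma>)" by (simp add: phi_Ne_def field_simps)
    have "y * (3 * (1 - x\<^sup>2) + y\<^sup>2) = 0"
      using arg_cong[OF eq, of Im] by (simp add: x_y_def power3_eq_cube power2_eq_square algebra_simps)
    moreover have "3 * (1 - x\<^sup>2) + y\<^sup>2 > 0"
      using zb(1) zero_le_power2[of y] by (smt (verit) zero_le_power2)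
    ultimately have "y = 0" by simp
    with arg_cong[OF eq, of Re] have "3 * x - x ^ 3 = - 3 * \<sigma>"
      by (simp add: x_y_def power3_eq_cube)
    moreover have "3 * x - x ^ 3 + 2 = (1 + x)\<^sup>2 * (2 - x)"
      by (simp add: power3_eq_cube power2_eq_square algebra_simps)
    moreover have "(1 + x)\<^sup>2 * (2 - x) \<ge> 0" using zb by simp
    ultimately show False using \<sigma> by linarith
  qed
qed (auto simp: phi_Ne_def[abs_def] intro!: holomorphic_intros continuous_intros)

theorem theorem5p1:
  shows
   "sharp_bound (4 / 9 * (2 + sqrt 2)) (\<lambda>z. csqrt (1 + z ^ 2) + z) \<and>
    sharp_bound (4 / 3) (\<lambda>z. 1 + 4 / 3 * z + 2 / 3 * z ^ 2) \<and>
    sharp_bound (16 / 63 * (1 + 2 * sqrt 2)) (\<lambda>z. 1 + of_real (sqrt 2) * z + 1 / 2 * z ^ 2) \<and>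
    sharp_bound (8 * exp 1 / (9 * (exp 1 - 1))) (\<lambda>z. exp z) \<and>
    sharp_bound (8 / (9 * sin 1)) (\<lambda>z. 1 + sin z) \<and>
    (let k = complex_of_real (1 + sqrt 2) in
      sharp_bound (8 / 9 * (3 + 2 * sqrt 2)) (\<lambda>z. 1 + z / k * ((k + z) / (k - z)))) \<and>
    sharp_bound (4 / 3) phi_Ne"
  unfolding Let_def
  by (intro conjI sharp_crescent sharp_cardioid sharp_limacon sharp_exp sharp_sin
      sharp_rational sharp_nephroid)

end
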